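(* Let $\Gamma\stackrel{\mathcal{T}}{\Rightarrow}\Delta$ be a possibly infinite tree sequent. If $\mathfrak{M},f\models\Gamma\stackrel{\mathcal{T}}{\Rightarrow}\Delta$ for all models $\mathfrak{M}$ and all $\mathcal{T}$-assignments $f$ in $\mathfrak{M}$, then $\Gamma\stackrel{\mathcal{T}}{\Rightarrow}\Delta$ is provable in $\mathsf{T}\mathbf{EFL}^{-}$.
   Context: Syntax. Disjoint countably infinite sets $\mathsf{Prop}$ and $\mathsf{Nom}$ (agent nominals). Formulas: $\varphi ::= n \mid p \mid \bot \mid \varphi\to\varphi \mid @_{n}\varphi \mid \mathsf{F}\varphi \mid \Box\varphi$; $\neg\varphi:=\varphi\to\bot$; $\langle\mathsf{F}\rangle\varphi:=\neg\mathsf{F}\neg\varphi$. $@$-prefixed formulas have the form $@_n\varphi$. $\varphi[m/k]$ replaces every occurrence of nominal $k$ by $m$. Semantics. A model $\mathfrak{M}=(W,A,(R_a)_{a\in A},(\asymp_w)_{w\in W},V)$: $W,A$ nonempty, $R_a\subseteq W\times W$, $\asymp_w\subseteq A\times A$, $V:\mathsf{Prop}\cup\mathsf{Nom}\to\mathcal{P}(W\times A)$ with $V(n)=W\times\{\underline n\}$ for a unique $\underline n\in A$. Satisfaction: $(w,a)\models p$ iff $(w,a)\in V(p)$; $(w,a)\models n$ iff $\underline n=a$; $\bot$ never; $\to$ classical; $(w,a)\models@_n\varphi$ iff $(w,\underline n)\models\varphi$; $(w,a)\models\mathsf{F}\varphi$ iff $(w,b)\models\varphi$ for all $b$ with $a\asymp_wb$;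 $(w,a)\models\Box\varphi$ iff $(v,a)\models\varphi$ for all $v$ with $wR_av$. Tree sequents. Labels: natural numbers, and $\alpha\cdot_ni$ (an $n$-child of $\alpha$). A tree: set of labels with exactly one natural number (root), closed under parents. Labelled formula: $\alpha:\psi$, $\psi$ $@$-prefixed. A finite tree sequent $\Gamma\stackrel{\mathcal{T}}{\Rightarrow}\Delta$ has finite $\Gamma,\Delta$ (sets of labelled formulas) and finite tree $\mathcal{T}$ containing their labels; a possibly infinite tree sequent allows $\Gamma,\Delta,\mathcal{T}$ to be countably infinite. A $\mathcal{T}$-assignment is $f:\mathcal{T}\to W$ with $f(\alpha)R_{\underline n}f(\beta)$ whenever $\beta\in\mathcal{T}$ is an $n$-child of $\alpha$. $\mathfrak{M},f\models\alpha:@_n\varphi$ iff $(f(\alpha),\underline n)\models\varphi$; $\mathfrak{M},f\models\Gamma\stackrel{\mathcal{T}}{\Rightarrow}\Delta$ iff truth of all of $\Gamma$ implies truth of some member of $\Delta$. Calculus $\mathsf{T}\mathbf{EFL}^{-}$ on finite tree sequents ($\alpha,\beta\in\mathcal{T}$; tree unchanged unless indicated). Initial: $\alpha:@_n\bot,\Gamma\Rightarrow\Delta$; $\alpha:@_n\varphi,\Gamma\Rightarrow\Delta,\alpha:@_n\varphi$. Rules (premises / conclusion): $(\mathsf{rep}_{=1})$ $\alpha:@_nm,\alpha:\varphi[n/k],\Gamma\Rightarrow\Delta$ / $\alpha:@_nm,\alpha:\varphi[m/k],\Gamma\Rightarrow\Delta$; $(\mathsf{rep}_{=2})$ $\alpha:@_nm,\alpha:\varphi[m/k],\Gamma\Rightarrow\Delta$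 / $\alpha:@_nm,\alpha:\varphi[n/k],\Gamma\Rightarrow\Delta$; $(\mathsf{ref}_=)$ $\alpha:@_nn,\Gamma\Rightarrow\Delta$ / $\Gamma\Rightarrow\Delta$; $(\mathsf{rigid}_=)$ $\beta:@_nm,\Gamma\Rightarrow\Delta$ / $\alpha:@_nm,\Gamma\Rightarrow\Delta$; $(\to R)$ $\alpha:@_n\varphi,\Gamma\Rightarrow\Delta,\alpha:@_n\psi$ / $\Gamma\Rightarrow\Delta,\alpha:@_n(\varphi\to\psi)$; $(\to L)$ $\Gamma\Rightarrow\Delta,\alpha:@_n\varphi$ and $\alpha:@_n\psi,\Gamma\Rightarrow\Delta$ / $\alpha:@_n(\varphi\to\psi),\Gamma\Rightarrow\Delta$; $(@R)$ $\Gamma\Rightarrow\Delta,\alpha:@_m\varphi$ / $\Gamma\Rightarrow\Delta,\alpha:@_n@_m\varphi$; $(@L)$ $\alpha:@_m\varphi,\Gamma\Rightarrow\Delta$ / $\alpha:@_n@_m\varphi,\Gamma\Rightarrow\Delta$; $(\mathsf{F}R)$ $\alpha:@_n\langle\mathsf{F}\rangle m,\Gamma\Rightarrow\Delta,\alpha:@_m\varphi$ / $\Gamma\Rightarrow\Delta,\alpha:@_n\mathsf{F}\varphi$, $m$ not in the conclusion; $(\mathsf{F}L)$ $\Gamma\Rightarrow\Delta,\alpha:@_n\langle\mathsf{F}\rangle m$ and $\alpha:@_m\varphi,\Gamma\Rightarrow\Delta$ / $\alpha:@_n\mathsf{F}\varphi,\Gamma\Rightarrow\Delta$; $(\Box R)$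 $\Gamma\stackrel{\mathcal{T}\cup\{\alpha\cdot_ni\}}{\Rightarrow}\Delta,\alpha\cdot_ni:@_n\varphi$ / $\Gamma\stackrel{\mathcal{T}}{\Rightarrow}\Delta,\alpha:@_n\Box\varphi$, $i$ fresh in the conclusion; $(\Box L)$ $\beta:@_n\varphi,\Gamma\Rightarrow\Delta$ / $\alpha:@_n\Box\varphi,\Gamma\Rightarrow\Delta$, $\beta$ an $n$-child of $\alpha$; $(w\mathsf{lab})$ $\Gamma\stackrel{\mathcal{T}}{\Rightarrow}\Delta$ / $\Gamma\stackrel{\mathcal{T}\cup\{\alpha\}}{\Rightarrow}\Delta$ if $\mathcal{T}\cup\{\alpha\}$ is a tree. (No cut rule.) A possibly infinite tree sequent $\Gamma\stackrel{\mathcal{T}}{\Rightarrow}\Delta$ is provable in $\mathsf{T}\mathbf{EFL}^{-}$ if some $\Gamma'\stackrel{\mathcal{T}'}{\Rightarrow}\Delta'$ with finite $\Gamma'\subseteq\Gamma$, $\Delta'\subseteq\Delta$ and finite subtree $\mathcal{T}'\subseteq\mathcal{T}$ has a finite derivation. *)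

theory Defs
  imports "HOL-Library.Countable" "HOL-Library.Infinite_Typeclass"
begin

datatype (props: 'p, noms: 'n) fm =
    Nom 'n
  | Pro 'p
  | Bot
  | Imp "('p, 'n) fm" "('p, 'n) fm"
  | At 'n "('p, 'n) fm"
  | Fr "('p, 'n) fm"
  | Box "('p, 'n) fm"

definition Neg :: "('p, 'n) fm \<Rightarrow> ('p, 'n) fm" where
  "Neg \<phi> = Imp \<phi> Bot"

definition DiaF :: "('p, 'n) fm \<Rightarrow> ('p, 'n) fm" where
  "DiaF \<phi> = Neg (Fr (Neg \<phi>))"

definition at_prefixed :: "('p, 'n) fm \<Rightarrow> bool" where
  "at_prefixed \<psi> \<longleftrightarrow> (\<exists>n \<phi>. \<psi> = At n \<phi>)"

text \<open>\<open>subst \<phi> m k\<close> is \<open>\<phi>[m/k]\<close>: every occurrence of \<open>k\<close>, including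
  those as index of an \<open>At\<close>, becomes \<open>m\<close>.\<close>

definition subst :: "('p, 'n) fm \<Rightarrow> 'n \<Rightarrow> 'n \<Rightarrow> ('p, 'n) fm" where
  "subst \<phi> m k = map_fm id (id(k := m)) \<phi>"


subsection \<open>Models\<close>

text \<open>The valuation is defined on the disjoint union of propositional variables and nominals.
  Worlds and agents are carrier sets, so that models of all sizes up to that of the
  types \<open>'w\<close> and \<open>'a\<close> are covered.\<close>

record ('w, 'a, 'p, 'n) model =
  worlds :: "'w set"
  agents :: "'a set"
  know   :: "'a \<Rightarrow> ('w \<times> 'w) set"
  friend :: "'w \<Rightarrow> ('a \<times> 'a) set"
  val    :: "'p + 'n \<Rightarrow> ('w \<times> 'a) set"

definition is_model :: "('w, 'a, 'p, 'n) model \<Rightarrow> bool" where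
  "is_model M \<longleftrightarrow>
     worlds M \<noteq> {} \<and> agents M \<noteq> {} \<and>
     (\<forall>a \<in> agents M. know M a \<subseteq> worlds M \<times> worlds M) \<and>
     (\<forall>w \<in> worlds M. friend M w \<subseteq> agents M \<times> agents M) \<and>
     (\<forall>x. val M x \<subseteq> worlds M \<times> agents M) \<and>
     (\<forall>n. \<exists>!a. a \<in> agents M \<and> val M (Inr n) = worlds M \<times> {a})"

definition denot :: "('w, 'a, 'p, 'n) model \<Rightarrow> 'n \<Rightarrow> 'a" where
  "denot M n = (THE a. a \<in> agents M \<and> val M (Inr n) = worlds M \<times> {a})"

primrec sat :: "('w, 'a, 'p, 'n) model \<Rightarrow> 'w \<Rightarrow> 'a \<Rightarrow> ('p, 'n) fm \<Rightarrow> bool" where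
  "sat M w a (Nom n) \<longleftrightarrow> denot M n = a"
| "sat M w a (Pro p) \<longleftrightarrow> (w, a) \<in> val M (Inl p)"
| "sat M w a Bot \<longleftrightarrow> False"
| "sat M w a (Imp \<phi> \<psi>) \<longleftrightarrow> (sat M w a \<phi> \<longrightarrow> sat M w a \<psi>)"
| "sat M w a (At n \<phi>) \<longleftrightarrow> sat M w (denot M n) \<phi>"
| "sat M w a (Fr \<phi>) \<longleftrightarrow> (\<forall>b. (a, b) \<in> friend M w \<longrightarrow> sat M w b \<phi>)"
| "sat M w a (Box \<phi>) \<longleftrightarrow> (\<forall>v. (w, v) \<in> know M a \<longrightarrow> sat M v a \<phi>)"


subsection \<open>Tree sequents\<close>

text \<open>\<open>Child \<alpha> n i\<close> is the \<open>n\<close>-child \<open>\<alpha> \<cdot>\<^sub>n i\<close> of \<open>\<alpha>\<close>.\<close>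

datatype (lab_noms: 'n) label = Root nat | Child "'n label" 'n nat

primrec lab_nats :: "'n label \<Rightarrow> nat set" where
  "lab_nats (Root i) = {i}"
| "lab_nats (Child \<alpha> n i) = insert i (lab_nats \<alpha>)"

definition tree :: "'n label set \<Rightarrow> bool" where
  "tree T \<longleftrightarrow> (\<exists>!i. Root i \<in> T) \<and> (\<forall>\<alpha> n i. Child \<alpha> n i \<in> T \<longrightarrow> \<alpha> \<in> T)"

type_synonym ('p, 'n) lfm = "'n label \<times> ('p, 'n) fm"

text \<open>No cardinality restriction is needed for possibly infinite sequents: for countable
  \<open>'p\<close> and \<open>'n\<close> the types of labels and labelled formulas are countable.\<close>

definition tree_sequent ::
    "('p, 'n) lfm set \<Rightarrow> 'n label set \<Rightarrow> ('p, 'n) lfm set \<Rightarrow> bool" where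
  "tree_sequent \<Gamma> T \<Delta> \<longleftrightarrow>
     tree T \<and> (\<forall>(\<alpha>, \<psi>) \<in> \<Gamma> \<union> \<Delta>. \<alpha> \<in> T \<and> at_prefixed \<psi>)"

definition fin_tree_sequent ::
    "('p, 'n) lfm set \<Rightarrow> 'n label set \<Rightarrow> ('p, 'n) lfm set \<Rightarrow> bool" where
  "fin_tree_sequent \<Gamma> T \<Delta> \<longleftrightarrow>
     tree_sequent \<Gamma> T \<Delta> \<and> finite \<Gamma> \<and> finite T \<and> finite \<Delta>"

definition assignment ::
    "('w, 'a, 'p, 'n) model \<Rightarrow> 'n label set \<Rightarrow> ('n label \<Rightarrow> 'w) \<Rightarrow> bool" where
  "assignment M T f \<longleftrightarrow>
     (\<forall>\<alpha> \<in> T. f \<alpha> \<in> worlds M) \<and>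
     (\<forall>\<alpha> n i. \<alpha> \<in> T \<and> Child \<alpha> n i \<in> T \<longrightarrow> (f \<alpha>, f (Child \<alpha> n i)) \<in> know M (denot M n))"

definition sat_lfm ::
    "('w, 'a, 'p, 'n) model \<Rightarrow> ('n label \<Rightarrow> 'w) \<Rightarrow> ('p, 'n) lfm \<Rightarrow> bool" where
  "sat_lfm M f x \<longleftrightarrow> (\<exists>\<alpha> n \<phi>. x = (\<alpha>, At n \<phi>) \<and> sat M (f \<alpha>) (denot M n) \<phi>)"

definition sat_sequent ::
    "('w, 'a, 'p, 'n) model \<Rightarrow> ('n label \<Rightarrow> 'w) \<Rightarrow> ('p, 'n) lfm set \<Rightarrow> ('p, 'n) lfm set \<Rightarrow> bool" where
  "sat_sequent M f \<Gamma> \<Delta> \<longleftrightarrow>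
     ((\<forall>x \<in> \<Gamma>. sat_lfm M f x) \<longrightarrow> (\<exists>x \<in> \<Delta>. sat_lfm M f x))"


subsection \<open>The calculus\<close>

text \<open>A nominal can also occur in a sequent inside a label of its tree; freshness for the
  rule \<open>FR\<close> has to exclude this.\<close>

definition seq_noms ::
    "('p, 'n) lfm set \<Rightarrow> 'n label set \<Rightarrow> ('p, 'n) lfm set \<Rightarrow> 'n set" where
  "seq_noms \<Gamma> T \<Delta> = (\<Union>(\<alpha>, \<psi>) \<in> \<Gamma> \<union> \<Delta>. lab_noms \<alpha> \<union> noms \<psi>) \<union> (\<Union>\<alpha> \<in> T. lab_noms \<alpha>)"

definition seq_nats ::
    "('p, 'n) lfm set \<Rightarrow> 'n label set \<Rightarrow> ('p, 'n) lfm set \<Rightarrow> nat set" where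
  "seq_nats \<Gamma> T \<Delta> = (\<Union>(\<alpha>, \<psi>) \<in> \<Gamma> \<union> \<Delta>. lab_nats \<alpha>) \<union> (\<Union>\<alpha> \<in> T. lab_nats \<alpha>)"

text \<open>Each rule requires its conclusion to be a finite tree sequent; for its premises this
  follows by induction. This also guarantees that the labels \<open>\<alpha>\<close> and \<open>\<beta>\<close> belong to \<open>T\<close>.\<close>

inductive derivable ::
    "('p, 'n) lfm set \<Rightarrow> 'n label set \<Rightarrow> ('p, 'n) lfm set \<Rightarrow> bool" where
  init_bot:
  "fin_tree_sequent (insert (\<alpha>, At n Bot) \<Gamma>) T \<Delta> \<Longrightarrow>
   derivable (insert (\<alpha>, At n Bot) \<Gamma>) T \<Delta>"
| init_id:
  "fin_tree_sequent (insert (\<alpha>, At n \<phi>) \<Gamma>) T (insert (\<alpha>, At n \<phi>) \<Delta>) \<Longrightarrow>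
   derivable (insert (\<alpha>, At n \<phi>) \<Gamma>) T (insert (\<alpha>, At n \<phi>) \<Delta>)"
| rep1:
  "derivable (insert (\<alpha>, At n (Nom m)) (insert (\<alpha>, subst \<phi> n k) \<Gamma>)) T \<Delta> \<Longrightarrow>
   fin_tree_sequent (insert (\<alpha>, At n (Nom m)) (insert (\<alpha>, subst \<phi> m k) \<Gamma>)) T \<Delta> \<Longrightarrow>
   derivable (insert (\<alpha>, At n (Nom m)) (insert (\<alpha>, subst \<phi> m k) \<Gamma>)) T \<Delta>"
| rep2:
  "derivable (insert (\<alpha>, At n (Nom m)) (insert (\<alpha>, subst \<phi> m k) \<Gamma>)) T \<Delta> \<Longrightarrow>
   fin_tree_sequent (insert (\<alpha>, At n (Nom m)) (insert (\<alpha>, subst \<phi> n k) \<Gamma>)) T \<Delta> \<Longrightarrow>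
   derivable (insert (\<alpha>, At n (Nom m)) (insert (\<alpha>, subst \<phi> n k) \<Gamma>)) T \<Delta>"
| ref:
  "derivable (insert (\<alpha>, At n (Nom n)) \<Gamma>) T \<Delta> \<Longrightarrow>
   fin_tree_sequent \<Gamma> T \<Delta> \<Longrightarrow>
   derivable \<Gamma> T \<Delta>"
| rigid:
  "derivable (insert (\<beta>, At n (Nom m)) \<Gamma>) T \<Delta> \<Longrightarrow>
   fin_tree_sequent (insert (\<alpha>, At n (Nom m)) \<Gamma>) T \<Delta> \<Longrightarrow>
   derivable (insert (\<alpha>, At n (Nom m)) \<Gamma>) T \<Delta>"
| ImpR:
  "derivable (insert (\<alpha>, At n \<phi>) \<Gamma>) T (insert (\<alpha>, At n \<psi>) \<Delta>) \<Longrightarrow>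
   fin_tree_sequent \<Gamma> T (insert (\<alpha>, At n (Imp \<phi> \<psi>)) \<Delta>) \<Longrightarrow>
   derivable \<Gamma> T (insert (\<alpha>, At n (Imp \<phi> \<psi>)) \<Delta>)"
| ImpL:
  "derivable \<Gamma> T (insert (\<alpha>, At n \<phi>) \<Delta>) \<Longrightarrow>
   derivable (insert (\<alpha>, At n \<psi>) \<Gamma>) T \<Delta> \<Longrightarrow>
   fin_tree_sequent (insert (\<alpha>, At n (Imp \<phi> \<psi>)) \<Gamma>) T \<Delta> \<Longrightarrow>
   derivable (insert (\<alpha>, At n (Imp \<phi> \<psi>)) \<Gamma>) T \<Delta>"
| AtR:
  "derivable \<Gamma> T (insert (\<alpha>, At m \<phi>) \<Delta>) \<Longrightarrow>
   fin_tree_sequent \<Gamma> T (insert (\<alpha>, At n (At m \<phi>)) \<Delta>) \<Longrightarrow>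
   derivable \<Gamma> T (insert (\<alpha>, At n (At m \<phi>)) \<Delta>)"
| AtL:
  "derivable (insert (\<alpha>, At m \<phi>) \<Gamma>) T \<Delta> \<Longrightarrow>
   fin_tree_sequent (insert (\<alpha>, At n (At m \<phi>)) \<Gamma>) T \<Delta> \<Longrightarrow>
   derivable (insert (\<alpha>, At n (At m \<phi>)) \<Gamma>) T \<Delta>"
| FR:
  "derivable (insert (\<alpha>, At n (DiaF (Nom m))) \<Gamma>) T (insert (\<alpha>, At m \<phi>) \<Delta>) \<Longrightarrow>
   m \<notin> seq_noms \<Gamma> T (insert (\<alpha>, At n (Fr \<phi>)) \<Delta>) \<Longrightarrow>
   fin_tree_sequent \<Gamma> T (insert (\<alpha>, At n (Fr \<phi>)) \<Delta>) \<Longrightarrow>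
   derivable \<Gamma> T (insert (\<alpha>, At n (Fr \<phi>)) \<Delta>)"
| FL:
  "derivable \<Gamma> T (insert (\<alpha>, At n (DiaF (Nom m))) \<Delta>) \<Longrightarrow>
   derivable (insert (\<alpha>, At m \<phi>) \<Gamma>) T \<Delta> \<Longrightarrow>
   fin_tree_sequent (insert (\<alpha>, At n (Fr \<phi>)) \<Gamma>) T \<Delta> \<Longrightarrow>
   derivable (insert (\<alpha>, At n (Fr \<phi>)) \<Gamma>) T \<Delta>"
| BoxR:
  "derivable \<Gamma> (insert (Child \<alpha> n i) T) (insert (Child \<alpha> n i, At n \<phi>) \<Delta>) \<Longrightarrow>
   i \<notin> seq_nats \<Gamma> T (insert (\<alpha>, At n (Box \<phi>)) \<Delta>) \<Longrightarrow>
   fin_tree_sequent \<Gamma> T (insert (\<alpha>, At n (Box \<phi>)) \<Delta>) \<Longrightarrow>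
   derivable \<Gamma> T (insert (\<alpha>, At n (Box \<phi>)) \<Delta>)"
| BoxL:
  "derivable (insert (\<beta>, At n \<phi>) \<Gamma>) T \<Delta> \<Longrightarrow>
   \<beta> = Child \<alpha> n i \<Longrightarrow>
   fin_tree_sequent (insert (\<alpha>, At n (Box \<phi>)) \<Gamma>) T \<Delta> \<Longrightarrow>
   derivable (insert (\<alpha>, At n (Box \<phi>)) \<Gamma>) T \<Delta>"
| wlab:
  "derivable \<Gamma> T \<Delta> \<Longrightarrow>
   fin_tree_sequent \<Gamma> (insert \<alpha> T) \<Delta> \<Longrightarrow>
   derivable \<Gamma> (insert \<alpha> T) \<Delta>"

definition provable ::
    "('p, 'n) lfm set \<Rightarrow> 'n label set \<Rightarrow> ('p, 'n) lfm set \<Rightarrow> bool" where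
  "provable \<Gamma> T \<Delta> \<longleftrightarrow>
     (\<exists>\<Gamma>' T' \<Delta>'. \<Gamma>' \<subseteq> \<Gamma> \<and> finite \<Gamma>' \<and> T' \<subseteq> T \<and> finite T' \<and> tree T' \<and>
        \<Delta>' \<subseteq> \<Delta> \<and> finite \<Delta>' \<and> derivable \<Gamma>' T' \<Delta>')"

end

theory Submission
  imports Defs "HOL-Library.Product_Order"
begin

text \<open>An unprovable sequent is extended to an unprovable one that is maximal on either side and
  has witnesses for the \<open>F\<close>- and \<open>\<box>\<close>-formulas on its right-hand side; its labels, and its nominals
  modulo the equations on the left, are the worlds and agents of a countermodel. Without cut a
  formula may be on neither side of a maximal sequent, so the truth lemma only concerns formulas
  that do occur. The given sequent may already use all nominals and all numbers, so it is first
  renamed injectively to leave infinitely many of both fresh. Derivations are stable under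
  arbitrary renamings, so a derivation of the renamed sequent can be renamed back, and a
  countermodel of the renamed sequent has a reduct that is one of the original.\<close>


subsection \<open>Renaming nominals and numbers\<close>

primrec rename_label :: "('n \<Rightarrow> 'm) \<Rightarrow> (nat \<Rightarrow> nat) \<Rightarrow> 'n label \<Rightarrow> 'm label" where
  "rename_label \<sigma> \<tau> (Root i) = Root (\<tau> i)"
| "rename_label \<sigma> \<tau> (Child \<alpha> n i) = Child (rename_label \<sigma> \<tau> \<alpha>) (\<sigma> n) (\<tau> i)"

definition rename_lfm :: "('n \<Rightarrow> 'm) \<Rightarrow> (nat \<Rightarrow> nat) \<Rightarrow> ('p, 'n) lfm \<Rightarrow> ('p, 'm) lfm" where
  "rename_lfm \<sigma> \<tau> = map_prod (rename_label \<sigma> \<tau>) (map_fm id \<sigma>)"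

lemma rename_lfm_Pair [simp]: "rename_lfm \<sigma> \<tau> (\<alpha>, \<psi>) = (rename_label \<sigma> \<tau> \<alpha>, map_fm id \<sigma> \<psi>)"
  by (simp add: rename_lfm_def)

lemma rename_label_comp:
  "rename_label \<sigma>' \<tau>' (rename_label \<sigma> \<tau> \<alpha>) = rename_label (\<sigma>' \<circ> \<sigma>) (\<tau>' \<circ> \<tau>) \<alpha>"
  by (induction \<alpha>) auto

lemma rename_lfm_comp: "rename_lfm \<sigma>' \<tau>' (rename_lfm \<sigma> \<tau> x) = rename_lfm (\<sigma>' \<circ> \<sigma>) (\<tau>' \<circ> \<tau>) x"
  by (cases x) (simp add: rename_label_comp fm.map_comp)

lemma rename_label_id [simp]: "rename_label id id \<alpha> = \<alpha>"
  by (induction \<alpha>) auto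

lemma rename_lfm_id [simp]: "rename_lfm id id x = x"
  by (cases x) (simp add: fm.map_id)

lemma rename_label_cong:
  assumes "\<And>n. n \<in> lab_noms \<alpha> \<Longrightarrow> \<sigma> n = \<sigma>' n" "\<And>i. i \<in> lab_nats \<alpha> \<Longrightarrow> \<tau> i = \<tau>' i"
  shows "rename_label \<sigma> \<tau> \<alpha> = rename_label \<sigma>' \<tau>' \<alpha>"
  using assms by (induction \<alpha>) auto

lemma rename_lfm_cong:
  assumes "\<And>n. n \<in> lab_noms (fst x) \<union> noms (snd x) \<Longrightarrow> \<sigma> n = \<sigma>' n"
    and "\<And>i. i \<in> lab_nats (fst x) \<Longrightarrow> \<tau> i = \<tau>' i"
  shows "rename_lfm \<sigma> \<tau> x = rename_lfm \<sigma>' \<tau>' x"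
  using assms by (cases x) (auto intro!: rename_label_cong fm.map_cong)

lemma lab_noms_rename_label: "lab_noms (rename_label \<sigma> \<tau> \<alpha>) = \<sigma> ` lab_noms \<alpha>"
  by (induction \<alpha>) auto

lemma lab_nats_rename_label: "lab_nats (rename_label \<sigma> \<tau> \<alpha>) = \<tau> ` lab_nats \<alpha>"
  by (induction \<alpha>) auto

lemma seq_noms_rename_subset:
  "seq_noms (rename_lfm \<sigma> \<tau> ` \<Gamma>) (rename_label \<sigma> \<tau> ` T) (rename_lfm \<sigma> \<tau> ` \<Delta>) \<subseteq> range \<sigma>"
  by (auto simp: seq_noms_def lab_noms_rename_label fm.set_map)

lemma seq_nats_rename_subset:
  "seq_nats (rename_lfm \<sigma> \<tau> ` \<Gamma>) (rename_label \<sigma> \<tau> ` T) (rename_lfm \<sigma> \<tau> ` \<Delta>) \<subseteq> range \<tau>"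
  by (auto simp: seq_nats_def lab_nats_rename_label)

lemma rename_cong_sequent:
  assumes "\<forall>n\<in>seq_noms \<Gamma> T (insert x \<Delta>). \<sigma> n = \<sigma>' n"
    and "\<forall>i\<in>seq_nats \<Gamma> T (insert x \<Delta>). \<tau> i = \<tau>' i"
  shows "rename_lfm \<sigma> \<tau> ` \<Gamma> = rename_lfm \<sigma>' \<tau>' ` \<Gamma>"
    and "rename_label \<sigma> \<tau> ` T = rename_label \<sigma>' \<tau>' ` T"
    and "rename_lfm \<sigma> \<tau> ` \<Delta> = rename_lfm \<sigma>' \<tau>' ` \<Delta>"
    and "rename_lfm \<sigma> \<tau> x = rename_lfm \<sigma>' \<tau>' x"
proof -
  have lfm: "rename_lfm \<sigma> \<tau> y = rename_lfm \<sigma>' \<tau>' y" if "y \<in> \<Gamma> \<union> insert x \<Delta>" for y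
    by (intro rename_lfm_cong assms[rule_format])
      (use that in \<open>force simp: seq_noms_def seq_nats_def\<close>)+
  have label: "rename_label \<sigma> \<tau> \<alpha> = rename_label \<sigma>' \<tau>' \<alpha>" if "\<alpha> \<in> T" for \<alpha>
    by (intro rename_label_cong assms[rule_format])
      (use that in \<open>auto simp: seq_noms_def seq_nats_def\<close>)
  show "rename_lfm \<sigma> \<tau> ` \<Gamma> = rename_lfm \<sigma>' \<tau>' ` \<Gamma>" "rename_lfm \<sigma> \<tau> ` \<Delta> = rename_lfm \<sigma>' \<tau>' ` \<Delta>"
    "rename_label \<sigma> \<tau> ` T = rename_label \<sigma>' \<tau>' ` T" "rename_lfm \<sigma> \<tau> x = rename_lfm \<sigma>' \<tau>' x"
    using lfm label by (auto intro!: image_cong)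
qed

lemma map_fm_DiaF [simp]: "map_fm f \<sigma> (DiaF \<phi>) = DiaF (map_fm f \<sigma> \<phi>)"
  by (simp add: DiaF_def Neg_def)

lemma finite_noms [simp]: "finite (noms \<phi>)"
  by (induction \<phi>) auto

text \<open>The renaming may identify \<open>k\<close> with other nominals of \<open>\<phi>\<close>, so \<open>k\<close> is first renamed apart.\<close>

lemma ex_map_fm_subst:
  fixes \<sigma> :: "'n \<Rightarrow> 'm::infinite"
  shows "\<exists>\<phi>' k'. \<forall>n. map_fm id \<sigma> (subst \<phi> n k) = subst \<phi>' (\<sigma> n) k'"
proof -
  obtain k' where "k' \<notin> \<sigma> ` noms \<phi>"
    using arb_element[of "\<sigma> ` noms \<phi>"] by auto
  then have "map_fm id \<sigma> (subst \<phi> n k) = subst (map_fm id (\<sigma>(k := k')) \<phi>) (\<sigma> n) k'" for n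
    unfolding subst_def fm.map_comp by (intro fm.map_cong) auto
  then show ?thesis
    by blast
qed


subsection \<open>Trees and tree sequents\<close>

primrec ancestors :: "'n label \<Rightarrow> 'n label set" where
  "ancestors (Root i) = {Root i}"
| "ancestors (Child \<alpha> n i) = insert (Child \<alpha> n i) (ancestors \<alpha>)"

lemma self_in_ancestors [simp]: "\<alpha> \<in> ancestors \<alpha>"
  by (cases \<alpha>) auto

lemma finite_ancestors [simp]: "finite (ancestors \<alpha>)"
  by (induction \<alpha>) auto

lemma tree_insert_Child: "tree T \<Longrightarrow> \<alpha> \<in> T \<Longrightarrow> tree (insert (Child \<alpha> n i) T)"
  by (auto simp: tree_def)

lemma tree_ancestors: "tree (ancestors \<alpha>)"
  by (induction \<alpha>) (simp_all add: tree_insert_Child, simp add: tree_def)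

lemma ancestors_subset: "tree T \<Longrightarrow> \<alpha> \<in> T \<Longrightarrow> ancestors \<alpha> \<subseteq> T"
  by (induction \<alpha>) (auto simp: tree_def)

lemma tree_Root_unique: "tree T \<Longrightarrow> Root i \<in> T \<Longrightarrow> Root j \<in> T \<Longrightarrow> i = j"
  by (auto simp: tree_def)

lemma tree_obtain_Root:
  assumes "tree T"
  obtains r where "Root r \<in> T"
  using assms by (auto simp: tree_def)

lemma tree_parent: "tree T \<Longrightarrow> Child \<alpha> n i \<in> T \<Longrightarrow> \<alpha> \<in> T"
  unfolding tree_def by blast

lemma tree_subset_Root: "tree T \<Longrightarrow> tree T' \<Longrightarrow> T' \<subseteq> T \<Longrightarrow> Root r \<in> T \<Longrightarrow> Root r \<in> T'"
  by (metis tree_Root_unique tree_obtain_Root subsetD)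

lemma tree_UN:
  assumes "\<And>i. i \<in> I \<Longrightarrow> tree (A i)" "\<And>i. i \<in> I \<Longrightarrow> Root r \<in> A i" "I \<noteq> {}"
  shows "tree (\<Union>i\<in>I. A i)"
  unfolding tree_def
proof (intro conjI allI impI)
  show "\<exists>!k. Root k \<in> (\<Union>i\<in>I. A i)"
    using assms by (intro ex1I[of _ r]) (auto dest: tree_Root_unique)
  show "\<alpha> \<in> (\<Union>i\<in>I. A i)" if "Child \<alpha> n k \<in> (\<Union>i\<in>I. A i)" for \<alpha> n k
    using assms(1) that tree_parent by (metis UN_iff)
qed

lemma finite_subtree:
  assumes "tree T" "finite F" "F \<subseteq> T"
  obtains T' where "finite T'" "tree T'" "F \<subseteq> T'" "T' \<subseteq> T"
proof -
  obtain r where r: "Root r \<in> T"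
    using assms(1) by (rule tree_obtain_Root)
  let ?F = "insert (Root r) F"
  have ancestors_T: "ancestors \<alpha> \<subseteq> T" if "\<alpha> \<in> ?F" for \<alpha>
    using that r assms ancestors_subset by blast
  have "tree (\<Union>\<alpha>\<in>?F. ancestors \<alpha>)"
    using ancestors_T tree_subset_Root[OF assms(1) tree_ancestors _ r]
    by (intro tree_UN tree_ancestors) auto
  moreover have "F \<subseteq> (\<Union>\<alpha>\<in>?F. ancestors \<alpha>)" "finite (\<Union>\<alpha>\<in>?F. ancestors \<alpha>)"
    using assms(2) by auto
  ultimately show thesis
    using ancestors_T that by blast
qed

lemma Root_in_rename_label_image:
  "Root i \<in> rename_label \<sigma> \<tau> ` T \<longleftrightarrow> (\<exists>j. Root j \<in> T \<and> \<tau> j = i)"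
proof
  assume "Root i \<in> rename_label \<sigma> \<tau> ` T"
  then obtain \<alpha> where "\<alpha> \<in> T" "rename_label \<sigma> \<tau> \<alpha> = Root i"
    by (metis imageE)
  then show "\<exists>j. Root j \<in> T \<and> \<tau> j = i"
    by (cases \<alpha>) auto
qed (auto intro: rev_image_eqI)

lemma tree_rename:
  assumes "tree T"
  shows "tree (rename_label \<sigma> \<tau> ` T)"
  unfolding tree_def
proof (intro conjI allI impI)
  show "\<exists>!i. Root i \<in> rename_label \<sigma> \<tau> ` T"
    using assms unfolding tree_def Root_in_rename_label_image by blast
  fix \<beta> n i assume "Child \<beta> n i \<in> rename_label \<sigma> \<tau> ` T"
  then obtain \<gamma> where "\<gamma> \<in> T" "rename_label \<sigma> \<tau> \<gamma> = Child \<beta> n i"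
    by (metis imageE)
  then show "\<beta> \<in> rename_label \<sigma> \<tau> ` T"
    using assms by (cases \<gamma>) (auto simp: tree_def)
qed

lemma at_prefixed_At [simp]: "at_prefixed (At n \<phi>)"
  by (simp add: at_prefixed_def)

lemma at_prefixed_map_fm [simp]: "at_prefixed (map_fm f \<sigma> \<psi>) = at_prefixed \<psi>"
  by (cases \<psi>) (auto simp: at_prefixed_def)

lemma at_prefixed_subst [simp]: "at_prefixed (subst \<psi> m k) = at_prefixed \<psi>"
  by (simp add: subst_def)

lemma tree_sequent_insert [simp]:
  "tree_sequent (insert x \<Gamma>) T \<Delta> \<longleftrightarrow> fst x \<in> T \<and> at_prefixed (snd x) \<and> tree_sequent \<Gamma> T \<Delta>"
  "tree_sequent \<Gamma> T (insert x \<Delta>) \<longleftrightarrow> fst x \<in> T \<and> at_prefixed (snd x) \<and> tree_sequent \<Gamma> T \<Delta>"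
  by (auto simp: tree_sequent_def)

lemma fin_tree_sequent_insert [simp]:
  "fin_tree_sequent (insert x \<Gamma>) T \<Delta> \<longleftrightarrow> fst x \<in> T \<and> at_prefixed (snd x) \<and> fin_tree_sequent \<Gamma> T \<Delta>"
  "fin_tree_sequent \<Gamma> T (insert x \<Delta>) \<longleftrightarrow> fst x \<in> T \<and> at_prefixed (snd x) \<and> fin_tree_sequent \<Gamma> T \<Delta>"
  by (auto simp: fin_tree_sequent_def)

lemma tree_sequent_insert_Child:
  "tree_sequent \<Gamma> T \<Delta> \<Longrightarrow> \<alpha> \<in> T \<Longrightarrow> tree_sequent \<Gamma> (insert (Child \<alpha> n i) T) \<Delta>"
  by (auto simp: tree_sequent_def tree_insert_Child)

lemma fin_tree_sequent_insert_Child: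
  "fin_tree_sequent \<Gamma> T \<Delta> \<Longrightarrow> \<alpha> \<in> T \<Longrightarrow> fin_tree_sequent \<Gamma> (insert (Child \<alpha> n i) T) \<Delta>"
  by (auto simp: fin_tree_sequent_def tree_sequent_insert_Child)

lemma tree_sequent_iff:
  "tree_sequent \<Gamma> T \<Delta> \<longleftrightarrow> tree T \<and> (\<forall>x\<in>\<Gamma> \<union> \<Delta>. fst x \<in> T \<and> at_prefixed (snd x))"
  by (simp add: tree_sequent_def case_prod_beta)

lemma tree_sequentD:
  assumes "tree_sequent \<Gamma> T \<Delta>" "(\<alpha>, \<psi>) \<in> \<Gamma> \<union> \<Delta>"
  shows "\<alpha> \<in> T" "at_prefixed \<psi>"
  using assms by (auto simp: tree_sequent_def)

lemma tree_sequent_rename: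
  "tree_sequent \<Gamma> T \<Delta> \<Longrightarrow>
   tree_sequent (rename_lfm \<sigma> \<tau> ` \<Gamma>) (rename_label \<sigma> \<tau> ` T) (rename_lfm \<sigma> \<tau> ` \<Delta>)"
  by (force simp: tree_sequent_def tree_rename)

lemma finite_lab_noms [simp]: "finite (lab_noms \<alpha>)"
  by (induction \<alpha>) auto

lemma finite_lab_nats [simp]: "finite (lab_nats \<alpha>)"
  by (induction \<alpha>) auto

lemma finite_seq_noms: "fin_tree_sequent \<Gamma> T \<Delta> \<Longrightarrow> finite (seq_noms \<Gamma> T \<Delta>)"
  by (auto simp: fin_tree_sequent_def seq_noms_def)

lemma finite_seq_nats: "fin_tree_sequent \<Gamma> T \<Delta> \<Longrightarrow> finite (seq_nats \<Gamma> T \<Delta>)"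
  by (auto simp: fin_tree_sequent_def seq_nats_def)

lemma seq_noms_insert:
  "seq_noms (insert x \<Gamma>) T \<Delta> = (lab_noms (fst x) \<union> noms (snd x)) \<union> seq_noms \<Gamma> T \<Delta>"
  "seq_noms \<Gamma> T (insert x \<Delta>) = (lab_noms (fst x) \<union> noms (snd x)) \<union> seq_noms \<Gamma> T \<Delta>"
  "seq_noms \<Gamma> (insert \<alpha> T) \<Delta> = lab_noms \<alpha> \<union> seq_noms \<Gamma> T \<Delta>"
  by (auto simp: seq_noms_def case_prod_beta)

lemma seq_nats_insert:
  "seq_nats (insert x \<Gamma>) T \<Delta> = lab_nats (fst x) \<union> seq_nats \<Gamma> T \<Delta>"
  "seq_nats \<Gamma> T (insert x \<Delta>) = lab_nats (fst x) \<union> seq_nats \<Gamma> T \<Delta>"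
  "seq_nats \<Gamma> (insert \<alpha> T) \<Delta> = lab_nats \<alpha> \<union> seq_nats \<Gamma> T \<Delta>"
  by (auto simp: seq_nats_def case_prod_beta)

lemma seq_noms_mono:
  "\<Gamma> \<subseteq> \<Gamma>' \<Longrightarrow> T \<subseteq> T' \<Longrightarrow> \<Delta> \<subseteq> \<Delta>' \<Longrightarrow> seq_noms \<Gamma> T \<Delta> \<subseteq> seq_noms \<Gamma>' T' \<Delta>'"
  unfolding seq_noms_def by (intro Un_mono UN_mono) auto

lemma seq_nats_mono:
  "\<Gamma> \<subseteq> \<Gamma>' \<Longrightarrow> T \<subseteq> T' \<Longrightarrow> \<Delta> \<subseteq> \<Delta>' \<Longrightarrow> seq_nats \<Gamma> T \<Delta> \<subseteq> seq_nats \<Gamma>' T' \<Delta>'"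
  unfolding seq_nats_def by (intro Un_mono UN_mono) auto

lemma derivable_fin_tree_sequent: "derivable \<Gamma> T \<Delta> \<Longrightarrow> fin_tree_sequent \<Gamma> T \<Delta>"
  by (induction rule: derivable.induct) simp_all


subsection \<open>Renaming and weakening\<close>

text \<open>Weakening is proved together with renaming, since the formulas added may contain the
  eigenvariables of a derivation.\<close>

definition derivable_renamed ::
    "('n \<Rightarrow> 'm) \<Rightarrow> (nat \<Rightarrow> nat) \<Rightarrow> ('p, 'n) lfm set \<Rightarrow> 'n label set \<Rightarrow> ('p, 'n) lfm set \<Rightarrow> bool" where
  "derivable_renamed \<sigma> \<tau> \<Gamma> T \<Delta> \<longleftrightarrow>
     (\<forall>\<Gamma>' T' \<Delta>'.
        fin_tree_sequent (rename_lfm \<sigma> \<tau> ` \<Gamma> \<union> \<Gamma>') (rename_label \<sigma> \<tau> ` T \<union> T')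
          (rename_lfm \<sigma> \<tau> ` \<Delta> \<union> \<Delta>') \<longrightarrow>
        derivable (rename_lfm \<sigma> \<tau> ` \<Gamma> \<union> \<Gamma>') (rename_label \<sigma> \<tau> ` T \<union> T')
          (rename_lfm \<sigma> \<tau> ` \<Delta> \<union> \<Delta>'))"

lemma derivable_renamed_FR:
  fixes \<sigma> :: "'n \<Rightarrow> 'm::infinite" and \<Gamma> \<Delta> :: "('p, 'n) lfm set"
  assumes premise: "\<And>\<sigma> :: 'n \<Rightarrow> 'm. derivable_renamed \<sigma> \<tau> (insert (\<alpha>, At n (DiaF (Nom m))) \<Gamma>) T
      (insert (\<alpha>, At m \<phi>) \<Delta>)"
    and fresh: "m \<notin> seq_noms \<Gamma> T (insert (\<alpha>, At n (Fr \<phi>)) \<Delta>)"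
  shows "derivable_renamed \<sigma> \<tau> \<Gamma> T (insert (\<alpha>, At n (Fr \<phi>)) \<Delta>)"
  unfolding derivable_renamed_def
proof (intro allI impI)
  fix \<Gamma>' \<Delta>' :: "('p, 'm) lfm set" and T'
  let ?\<Gamma> = "rename_lfm \<sigma> \<tau> ` \<Gamma> \<union> \<Gamma>'" and ?T = "rename_label \<sigma> \<tau> ` T \<union> T'"
    and ?\<Delta> = "rename_lfm \<sigma> \<tau> ` \<Delta> \<union> \<Delta>'"
  assume is_sequent: "fin_tree_sequent ?\<Gamma> ?T (rename_lfm \<sigma> \<tau> ` insert (\<alpha>, At n (Fr \<phi>)) \<Delta> \<union> \<Delta>')"
  obtain m' where fresh': "m' \<notin> seq_noms ?\<Gamma> ?T (rename_lfm \<sigma> \<tau> ` insert (\<alpha>, At n (Fr \<phi>)) \<Delta> \<union> \<Delta>')"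
    using arb_element finite_seq_noms[OF is_sequent] by blast
  define \<sigma>' where "\<sigma>' = \<sigma>(m := m')"
  have "derivable (insert (rename_label \<sigma> \<tau> \<alpha>, At (\<sigma> n) (DiaF (Nom m'))) ?\<Gamma>) ?T
      (insert (rename_label \<sigma> \<tau> \<alpha>, At m' (map_fm id \<sigma> \<phi>)) ?\<Delta>)"
  proof -
    have "\<forall>l\<in>seq_noms \<Gamma> T (insert (\<alpha>, At n (Fr \<phi>)) \<Delta>). \<sigma>' l = \<sigma> l"
      "\<forall>j\<in>seq_nats \<Gamma> T (insert (\<alpha>, At n (Fr \<phi>)) \<Delta>). \<tau> j = \<tau> j"
      using fresh by (auto simp: \<sigma>'_def)
    note renamed_eq = rename_cong_sequent[OF this]
    have "\<sigma>' m = m'"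
      by (simp add: \<sigma>'_def)
    with premise[of \<sigma>'] renamed_eq is_sequent show ?thesis
      by (simp add: derivable_renamed_def)
  qed
  from derivable.FR[OF this] fresh' is_sequent
  show "derivable ?\<Gamma> ?T (rename_lfm \<sigma> \<tau> ` insert (\<alpha>, At n (Fr \<phi>)) \<Delta> \<union> \<Delta>')"
    by simp
qed

lemma derivable_renamed_BoxR:
  assumes premise: "\<And>\<tau>. derivable_renamed \<sigma> \<tau> \<Gamma> (insert (Child \<alpha> n i) T)
      (insert (Child \<alpha> n i, At n \<phi>) \<Delta>)"
    and fresh: "i \<notin> seq_nats \<Gamma> T (insert (\<alpha>, At n (Box \<phi>)) \<Delta>)"
  shows "derivable_renamed \<sigma> \<tau> \<Gamma> T (insert (\<alpha>, At n (Box \<phi>)) \<Delta>)"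
  unfolding derivable_renamed_def
proof (intro allI impI)
  fix \<Gamma>' \<Delta>' T'
  let ?\<Gamma> = "rename_lfm \<sigma> \<tau> ` \<Gamma> \<union> \<Gamma>'" and ?T = "rename_label \<sigma> \<tau> ` T \<union> T'"
    and ?\<Delta> = "rename_lfm \<sigma> \<tau> ` \<Delta> \<union> \<Delta>'"
  assume is_sequent: "fin_tree_sequent ?\<Gamma> ?T (rename_lfm \<sigma> \<tau> ` insert (\<alpha>, At n (Box \<phi>)) \<Delta> \<union> \<Delta>')"
  obtain i' where fresh': "i' \<notin> seq_nats ?\<Gamma> ?T (rename_lfm \<sigma> \<tau> ` insert (\<alpha>, At n (Box \<phi>)) \<Delta> \<union> \<Delta>')"
    using arb_element finite_seq_nats[OF is_sequent] by blast
  define \<tau>' where "\<tau>' = \<tau>(i := i')"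
  have "derivable ?\<Gamma> (insert (Child (rename_label \<sigma> \<tau> \<alpha>) (\<sigma> n) i') ?T)
      (insert (Child (rename_label \<sigma> \<tau> \<alpha>) (\<sigma> n) i', At (\<sigma> n) (map_fm id \<sigma> \<phi>)) ?\<Delta>)"
  proof -
    have "\<forall>l\<in>seq_noms \<Gamma> T (insert (\<alpha>, At n (Box \<phi>)) \<Delta>). \<sigma> l = \<sigma> l"
      "\<forall>j\<in>seq_nats \<Gamma> T (insert (\<alpha>, At n (Box \<phi>)) \<Delta>). \<tau>' j = \<tau> j"
      using fresh by (auto simp: \<tau>'_def)
    note renamed_eq = rename_cong_sequent[OF this]
    have "\<tau>' i = i'"
      by (simp add: \<tau>'_def)
    with premise[of \<tau>'] renamed_eq is_sequent show ?thesis
      by (simp add: derivable_renamed_def fin_tree_sequent_insert_Child)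
  qed
  from derivable.BoxR[OF this] fresh' is_sequent
  show "derivable ?\<Gamma> ?T (rename_lfm \<sigma> \<tau> ` insert (\<alpha>, At n (Box \<phi>)) \<Delta> \<union> \<Delta>')"
    by simp
qed

lemma derivable_renamed:
  fixes \<sigma> :: "'n \<Rightarrow> 'm::infinite"
  assumes "derivable \<Gamma> T \<Delta>"
  shows "derivable_renamed \<sigma> \<tau> \<Gamma> T \<Delta>"
  using assms
proof (induction arbitrary: \<sigma> \<tau> rule: derivable.induct)
  case (rep1 \<alpha> n m \<phi> k \<Gamma> T \<Delta>)
  obtain \<phi>' k' where "\<forall>n. map_fm id \<sigma> (subst \<phi> n k) = subst \<phi>' (\<sigma> n) k'"
    using ex_map_fm_subst[of \<sigma> \<phi> k] by blast
  with rep1.IH[of \<sigma> \<tau>] show ?case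
    by (simp add: derivable_renamed_def derivable.rep1)
next
  case (rep2 \<alpha> n m \<phi> k \<Gamma> T \<Delta>)
  obtain \<phi>' k' where "\<forall>n. map_fm id \<sigma> (subst \<phi> n k) = subst \<phi>' (\<sigma> n) k'"
    using ex_map_fm_subst[of \<sigma> \<phi> k] by blast
  with rep2.IH[of \<sigma> \<tau>] show ?case
    by (simp add: derivable_renamed_def derivable.rep2)
next
  case (ref \<alpha> n \<Gamma> T \<Delta>)
  then show ?case
    using derivable_fin_tree_sequent[OF ref.hyps(1)]
    by (auto simp: derivable_renamed_def intro: derivable.ref[of "rename_label \<sigma> \<tau> \<alpha>" "\<sigma> n"])
next
  case (rigid \<beta> n m \<Gamma> T \<Delta> \<alpha>)
  then show ?case
    using derivable_fin_tree_sequent[OF rigid.hyps(1)]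
    by (auto simp: derivable_renamed_def intro: derivable.rigid[of "rename_label \<sigma> \<tau> \<beta>"])
next
  case (FR \<alpha> n m \<Gamma> T \<phi> \<Delta>)
  from FR.IH FR.hyps(2) show ?case
    by (rule derivable_renamed_FR)
next
  case (FL \<Gamma> T \<alpha> n m \<Delta> \<phi>)
  then show ?case
    by (simp add: derivable_renamed_def derivable.FL[where m = "\<sigma> m"])
next
  case (BoxR \<Gamma> \<alpha> n i T \<phi> \<Delta>)
  from BoxR.IH BoxR.hyps(2) show ?case
    by (rule derivable_renamed_BoxR)
next
  case (BoxL \<beta> n \<phi> \<Gamma> T \<Delta> \<alpha> i)
  then have "rename_label \<sigma> \<tau> \<beta> \<in> rename_label \<sigma> \<tau> ` T"
    using derivable_fin_tree_sequent by fastforce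
  with BoxL show ?case
    by (simp add: derivable_renamed_def derivable.BoxL[OF _ refl, where i = "\<tau> i"])
next
  case (wlab \<Gamma> T \<Delta> \<alpha>)
  from wlab.IH[of \<sigma> \<tau>] show ?case
    by (simp add: derivable_renamed_def flip: Un_insert_right)
qed (simp_all add: derivable_renamed_def derivable.init_bot derivable.init_id derivable.ImpR
    derivable.ImpL derivable.AtR derivable.AtL)

corollary derivable_rename:
  fixes \<sigma> :: "'n \<Rightarrow> 'm::infinite"
  assumes "derivable \<Gamma> T \<Delta>"
  shows "derivable (rename_lfm \<sigma> \<tau> ` \<Gamma>) (rename_label \<sigma> \<tau> ` T) (rename_lfm \<sigma> \<tau> ` \<Delta>)"
proof -
  have "fin_tree_sequent (rename_lfm \<sigma> \<tau> ` \<Gamma>) (rename_label \<sigma> \<tau> ` T) (rename_lfm \<sigma> \<tau> ` \<Delta>)"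
    using derivable_fin_tree_sequent[OF assms] tree_sequent_rename
    by (auto simp: fin_tree_sequent_def)
  then show ?thesis
    using derivable_renamed[OF assms, of \<sigma> \<tau>] unfolding derivable_renamed_def
    by (metis Un_empty_right)
qed

corollary derivable_weaken:
  fixes \<Gamma> \<Delta> :: "('p, 'n::infinite) lfm set"
  assumes "derivable \<Gamma> T \<Delta>" "\<Gamma> \<subseteq> \<Gamma>'" "T \<subseteq> T'" "\<Delta> \<subseteq> \<Delta>'" "fin_tree_sequent \<Gamma>' T' \<Delta>'"
  shows "derivable \<Gamma>' T' \<Delta>'"
  using derivable_renamed[OF assms(1), of id id] assms(2-)
  by (simp add: derivable_renamed_def) (metis Un_absorb1)


subsection \<open>Possibly infinite sequents\<close>

type_synonym ('p, 'n) sequent = "('p, 'n) lfm set \<times> 'n label set \<times> ('p, 'n) lfm set"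

definition fin_parts :: "('p, 'n) sequent \<Rightarrow> ('p, 'n) sequent set" where
  "fin_parts S = {(\<Gamma>\<^sub>0, T\<^sub>0, \<Delta>\<^sub>0). finite \<Gamma>\<^sub>0 \<and> finite T\<^sub>0 \<and> finite \<Delta>\<^sub>0 \<and> (\<Gamma>\<^sub>0, T\<^sub>0, \<Delta>\<^sub>0) \<le> S}"

definition fin_tree_sequents_between ::
    "('p, 'n) sequent \<Rightarrow> ('p, 'n) sequent \<Rightarrow> ('p, 'n) sequent set" where
  "fin_tree_sequents_between S\<^sub>0 S =
     {(\<Gamma>', T', \<Delta>'). fin_tree_sequent \<Gamma>' T' \<Delta>' \<and> S\<^sub>0 \<le> (\<Gamma>', T', \<Delta>') \<and> (\<Gamma>', T', \<Delta>') \<le> S}"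

text \<open>A derivation only uses a finite part of a sequent, and it can be weakened. Hence a sequent is
  provable iff eventually all of its finite subsequents are derivable, and every rule of the
  calculus carries over to infinite sequents premise by premise.\<close>

definition fin_subsequents ::
    "('p, 'n) lfm set \<Rightarrow> 'n label set \<Rightarrow> ('p, 'n) lfm set \<Rightarrow> ('p, 'n) sequent filter" where
  "fin_subsequents \<Gamma> T \<Delta> =
     (INF S\<^sub>0\<in>fin_parts (\<Gamma>, T, \<Delta>). principal (fin_tree_sequents_between S\<^sub>0 (\<Gamma>, T, \<Delta>)))"

lemma eventually_fin_subsequents:
  assumes "finite \<Gamma>\<^sub>0" "\<Gamma>\<^sub>0 \<subseteq> \<Gamma>" "finite T\<^sub>0" "T\<^sub>0 \<subseteq> T" "finite \<Delta>\<^sub>0" "\<Delta>\<^sub>0 \<subseteq> \<Delta>"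
  shows "\<forall>\<^sub>F (\<Gamma>', T', \<Delta>') in fin_subsequents \<Gamma> T \<Delta>. fin_tree_sequent \<Gamma>' T' \<Delta>' \<and>
    (\<Gamma>\<^sub>0, T\<^sub>0, \<Delta>\<^sub>0) \<le> (\<Gamma>', T', \<Delta>') \<and> (\<Gamma>', T', \<Delta>') \<le> (\<Gamma>, T, \<Delta>)"
  unfolding fin_subsequents_def using assms
  by (intro eventually_INF1[of "(\<Gamma>\<^sub>0, T\<^sub>0, \<Delta>\<^sub>0)"])
    (auto simp: eventually_principal fin_parts_def fin_tree_sequents_between_def)

lemma fin_tree_sequents_between_nonempty:
  assumes "tree_sequent \<Gamma> T \<Delta>" "S\<^sub>0 \<in> fin_parts (\<Gamma>, T, \<Delta>)"
  shows "fin_tree_sequents_between S\<^sub>0 (\<Gamma>, T, \<Delta>) \<noteq> {}"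
proof -
  obtain \<Gamma>\<^sub>0 T\<^sub>0 \<Delta>\<^sub>0 where S\<^sub>0: "S\<^sub>0 = (\<Gamma>\<^sub>0, T\<^sub>0, \<Delta>\<^sub>0)"
    by (cases S\<^sub>0)
  then have part: "finite \<Gamma>\<^sub>0" "\<Gamma>\<^sub>0 \<subseteq> \<Gamma>" "finite T\<^sub>0" "T\<^sub>0 \<subseteq> T" "finite \<Delta>\<^sub>0" "\<Delta>\<^sub>0 \<subseteq> \<Delta>"
    using assms(2) by (auto simp: fin_parts_def)
  then have labels: "finite (T\<^sub>0 \<union> fst ` (\<Gamma>\<^sub>0 \<union> \<Delta>\<^sub>0))" "T\<^sub>0 \<union> fst ` (\<Gamma>\<^sub>0 \<union> \<Delta>\<^sub>0) \<subseteq> T" "tree T"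
    using assms(1) unfolding tree_sequent_iff by blast+
  obtain T' where T': "finite T'" "tree T'" "T\<^sub>0 \<union> fst ` (\<Gamma>\<^sub>0 \<union> \<Delta>\<^sub>0) \<subseteq> T'" "T' \<subseteq> T"
    using finite_subtree[OF labels(3,1,2)] .
  have "\<forall>x\<in>\<Gamma>\<^sub>0 \<union> \<Delta>\<^sub>0. at_prefixed (snd x)"
    using assms(1) part(2,6) unfolding tree_sequent_iff by blast
  with T' part have "fin_tree_sequent \<Gamma>\<^sub>0 T' \<Delta>\<^sub>0"
    by (auto simp: fin_tree_sequent_def tree_sequent_iff)
  with T' part have "(\<Gamma>\<^sub>0, T', \<Delta>\<^sub>0) \<in> fin_tree_sequents_between S\<^sub>0 (\<Gamma>, T, \<Delta>)"
    by (simp add: fin_tree_sequents_between_def S\<^sub>0)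
  then show ?thesis
    by blast
qed

lemma fin_subsequents_neq_bot:
  assumes "tree_sequent \<Gamma> T \<Delta>"
  shows "fin_subsequents \<Gamma> T \<Delta> \<noteq> bot"
proof -
  let ?F = "\<lambda>S\<^sub>0. principal (fin_tree_sequents_between S\<^sub>0 (\<Gamma>, T, \<Delta>))"
  have directed: "\<exists>S\<in>fin_parts (\<Gamma>, T, \<Delta>). ?F S \<le> inf (?F S\<^sub>1) (?F S\<^sub>2)"
    if "S\<^sub>1 \<in> fin_parts (\<Gamma>, T, \<Delta>)" "S\<^sub>2 \<in> fin_parts (\<Gamma>, T, \<Delta>)" for S\<^sub>1 S\<^sub>2
    using that by (intro bexI[of _ "sup S\<^sub>1 S\<^sub>2"])
      (auto simp: fin_parts_def fin_tree_sequents_between_def)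
  have nonempty: "fin_parts (\<Gamma>, T, \<Delta>) \<noteq> {}"
    by (auto simp: fin_parts_def)
  have "\<not> eventually (\<lambda>_. False) (fin_subsequents \<Gamma> T \<Delta>)"
    using fin_tree_sequents_between_nonempty[OF assms] unfolding fin_subsequents_def
    by (subst eventually_INF_base[OF nonempty directed])
      (simp_all add: eventually_principal ex_in_conv del: split_paired_Ex)
  then show ?thesis
    by (simp add: trivial_limit_def)
qed

lemma provable_iff_derivable_subset:
  "provable \<Gamma> T \<Delta> \<longleftrightarrow> (\<exists>\<Gamma>' T' \<Delta>'. \<Gamma>' \<subseteq> \<Gamma> \<and> T' \<subseteq> T \<and> \<Delta>' \<subseteq> \<Delta> \<and> derivable \<Gamma>' T' \<Delta>')"
  unfolding provable_def using derivable_fin_tree_sequent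
  by (metis fin_tree_sequent_def tree_sequent_def)

lemma provable_mono:
  "provable \<Gamma> T \<Delta> \<Longrightarrow> \<Gamma> \<subseteq> \<Gamma>' \<Longrightarrow> T \<subseteq> T' \<Longrightarrow> \<Delta> \<subseteq> \<Delta>' \<Longrightarrow> provable \<Gamma>' T' \<Delta>'"
  unfolding provable_iff_derivable_subset by (meson subset_trans)

lemma eventually_derivable_Un:
  fixes \<Gamma> \<Delta> :: "('p, 'n::infinite) lfm set"
  assumes "provable (A \<union> \<Gamma>) (N \<union> T) (B \<union> \<Delta>)"
  shows "\<forall>\<^sub>F (\<Gamma>', T', \<Delta>') in fin_subsequents \<Gamma> T \<Delta>.
    fin_tree_sequent (A \<union> \<Gamma>') (N \<union> T') (B \<union> \<Delta>') \<longrightarrow> derivable (A \<union> \<Gamma>') (N \<union> T') (B \<union> \<Delta>')"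
proof -
  obtain \<Gamma>\<^sub>0 T\<^sub>0 \<Delta>\<^sub>0 where subset: "\<Gamma>\<^sub>0 \<subseteq> A \<union> \<Gamma>" "T\<^sub>0 \<subseteq> N \<union> T" "\<Delta>\<^sub>0 \<subseteq> B \<union> \<Delta>"
    and finite: "finite \<Gamma>\<^sub>0" "finite T\<^sub>0" "finite \<Delta>\<^sub>0" and derivable: "derivable \<Gamma>\<^sub>0 T\<^sub>0 \<Delta>\<^sub>0"
    using assms unfolding provable_def by blast
  have "\<forall>\<^sub>F (\<Gamma>', T', \<Delta>') in fin_subsequents \<Gamma> T \<Delta>. fin_tree_sequent \<Gamma>' T' \<Delta>' \<and>
      (\<Gamma>\<^sub>0 \<inter> \<Gamma>, T\<^sub>0 \<inter> T, \<Delta>\<^sub>0 \<inter> \<Delta>) \<le> (\<Gamma>', T', \<Delta>') \<and> (\<Gamma>', T', \<Delta>') \<le> (\<Gamma>, T, \<Delta>)"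
    using finite by (intro eventually_fin_subsequents) auto
  then show ?thesis
  proof eventually_elim
    case (elim S)
    obtain \<Gamma>' T' \<Delta>' where S: "S = (\<Gamma>', T', \<Delta>')"
      by (cases S)
    have "\<Gamma>\<^sub>0 \<subseteq> A \<union> \<Gamma>'" "T\<^sub>0 \<subseteq> N \<union> T'" "\<Delta>\<^sub>0 \<subseteq> B \<union> \<Delta>'"
      using elim subset by (auto simp: S)
    then show ?case
      using derivable_weaken[OF derivable] by (simp add: S)
  qed
qed

lemma eventually_member_left:
  assumes "x \<in> \<Gamma>"
  shows "\<forall>\<^sub>F (\<Gamma>', T', \<Delta>') in fin_subsequents \<Gamma> T \<Delta>.
    insert x \<Gamma>' = \<Gamma>' \<and> fst x \<in> T' \<and> at_prefixed (snd x) \<and> fin_tree_sequent \<Gamma>' T' \<Delta>'"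
  using assms eventually_fin_subsequents[of "{x}" \<Gamma> "{}" T "{}" \<Delta>]
  by (auto elim!: eventually_mono simp: fin_tree_sequent_def tree_sequent_iff)

lemma eventually_member_right:
  assumes "x \<in> \<Delta>"
  shows "\<forall>\<^sub>F (\<Gamma>', T', \<Delta>') in fin_subsequents \<Gamma> T \<Delta>.
    insert x \<Delta>' = \<Delta>' \<and> fst x \<in> T' \<and> at_prefixed (snd x) \<and> fin_tree_sequent \<Gamma>' T' \<Delta>'"
  using assms eventually_fin_subsequents[of "{}" \<Gamma> "{}" T "{x}" \<Delta>]
  by (auto elim!: eventually_mono simp: fin_tree_sequent_def tree_sequent_iff)

lemma eventually_member_tree:
  assumes "\<alpha> \<in> T"
  shows "\<forall>\<^sub>F (\<Gamma>', T', \<Delta>') in fin_subsequents \<Gamma> T \<Delta>. \<alpha> \<in> T' \<and> fin_tree_sequent \<Gamma>' T' \<Delta>'"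
  using assms eventually_fin_subsequents[of "{}" \<Gamma> "{\<alpha>}" T "{}" \<Delta>]
  by (auto elim!: eventually_mono)

lemma eventually_fresh_nom:
  assumes "m \<notin> seq_noms \<Gamma> T \<Delta>"
  shows "\<forall>\<^sub>F (\<Gamma>', T', \<Delta>') in fin_subsequents \<Gamma> T \<Delta>. m \<notin> seq_noms \<Gamma>' T' \<Delta>'"
  using eventually_fin_subsequents[of "{}" \<Gamma> "{}" T "{}" \<Delta>, simplified]
  by eventually_elim (use assms seq_noms_mono in blast)

lemma eventually_fresh_nat:
  assumes "i \<notin> seq_nats \<Gamma> T \<Delta>"
  shows "\<forall>\<^sub>F (\<Gamma>', T', \<Delta>') in fin_subsequents \<Gamma> T \<Delta>. i \<notin> seq_nats \<Gamma>' T' \<Delta>'"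
  using eventually_fin_subsequents[of "{}" \<Gamma> "{}" T "{}" \<Delta>, simplified]
  by eventually_elim (use assms seq_nats_mono in blast)

lemma eventually_derivable_insert_left:
  fixes \<Gamma> \<Delta> :: "('p, 'n::infinite) lfm set"
  assumes "provable (insert x \<Gamma>) T \<Delta>"
  shows "\<forall>\<^sub>F (\<Gamma>', T', \<Delta>') in fin_subsequents \<Gamma> T \<Delta>.
    fin_tree_sequent (insert x \<Gamma>') T' \<Delta>' \<longrightarrow> derivable (insert x \<Gamma>') T' \<Delta>'"
  using eventually_derivable_Un[of "{x}" \<Gamma> "{}" T "{}" \<Delta>] assms by simp

lemma eventually_derivable_insert_right:
  fixes \<Gamma> \<Delta> :: "('p, 'n::infinite) lfm set"
  assumes "provable \<Gamma> T (insert y \<Delta>)"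
  shows "\<forall>\<^sub>F (\<Gamma>', T', \<Delta>') in fin_subsequents \<Gamma> T \<Delta>.
    fin_tree_sequent \<Gamma>' T' (insert y \<Delta>') \<longrightarrow> derivable \<Gamma>' T' (insert y \<Delta>')"
  using eventually_derivable_Un[of "{}" \<Gamma> "{}" T "{y}" \<Delta>] assms by simp

lemma eventually_derivable_insert_both:
  fixes \<Gamma> \<Delta> :: "('p, 'n::infinite) lfm set"
  assumes "provable (insert x \<Gamma>) T (insert y \<Delta>)"
  shows "\<forall>\<^sub>F (\<Gamma>', T', \<Delta>') in fin_subsequents \<Gamma> T \<Delta>.
    fin_tree_sequent (insert x \<Gamma>') T' (insert y \<Delta>') \<longrightarrow> derivable (insert x \<Gamma>') T' (insert y \<Delta>')"
  using eventually_derivable_Un[of "{x}" \<Gamma> "{}" T "{y}" \<Delta>] assms by simp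

lemma eventually_derivable_insert_label:
  fixes \<Gamma> \<Delta> :: "('p, 'n::infinite) lfm set"
  assumes "provable \<Gamma> (insert \<alpha> T) (insert y \<Delta>)"
  shows "\<forall>\<^sub>F (\<Gamma>', T', \<Delta>') in fin_subsequents \<Gamma> T \<Delta>.
    fin_tree_sequent \<Gamma>' (insert \<alpha> T') (insert y \<Delta>') \<longrightarrow> derivable \<Gamma>' (insert \<alpha> T') (insert y \<Delta>')"
  using eventually_derivable_Un[of "{}" \<Gamma> "{\<alpha>}" T "{y}" \<Delta>] assms by simp

context
  fixes \<Gamma> \<Delta> :: "('p, 'n::infinite) lfm set" and T :: "'n label set"
  assumes is_sequent: "tree_sequent \<Gamma> T \<Delta>"
begin

lemma provable_iff_eventually_derivable:
  "provable \<Gamma> T \<Delta> \<longleftrightarrow> (\<forall>\<^sub>F (\<Gamma>', T', \<Delta>') in fin_subsequents \<Gamma> T \<Delta>. derivable \<Gamma>' T' \<Delta>')"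
proof
  assume "provable \<Gamma> T \<Delta>"
  then have "\<forall>\<^sub>F (\<Gamma>', T', \<Delta>') in fin_subsequents \<Gamma> T \<Delta>.
      fin_tree_sequent \<Gamma>' T' \<Delta>' \<longrightarrow> derivable \<Gamma>' T' \<Delta>'"
    using eventually_derivable_Un[of "{}" \<Gamma> "{}" T "{}" \<Delta>] by simp
  with eventually_fin_subsequents[of "{}" \<Gamma> "{}" T "{}" \<Delta>, simplified]
  show "\<forall>\<^sub>F (\<Gamma>', T', \<Delta>') in fin_subsequents \<Gamma> T \<Delta>. derivable \<Gamma>' T' \<Delta>'"
    by eventually_elim auto
next
  assume "\<forall>\<^sub>F (\<Gamma>', T', \<Delta>') in fin_subsequents \<Gamma> T \<Delta>. derivable \<Gamma>' T' \<Delta>'"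
  with eventually_fin_subsequents[of "{}" \<Gamma> "{}" T "{}" \<Delta>, simplified]
  have "\<forall>\<^sub>F (\<Gamma>', T', \<Delta>') in fin_subsequents \<Gamma> T \<Delta>.
      \<Gamma>' \<subseteq> \<Gamma> \<and> T' \<subseteq> T \<and> \<Delta>' \<subseteq> \<Delta> \<and> derivable \<Gamma>' T' \<Delta>'"
    by eventually_elim auto
  from eventually_happens'[OF fin_subsequents_neq_bot[OF is_sequent] this] show "provable \<Gamma> T \<Delta>"
    unfolding provable_iff_derivable_subset by auto
qed

lemma provable_init_bot:
  assumes "(\<alpha>, At n Bot) \<in> \<Gamma>"
  shows "provable \<Gamma> T \<Delta>"
  unfolding provable_iff_eventually_derivable
  using eventually_member_left[OF assms(1)]
  by eventually_elim (auto, metis derivable.init_bot)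

lemma provable_init_id:
  assumes "(\<alpha>, At n \<phi>) \<in> \<Gamma>"
    and "(\<alpha>, At n \<phi>) \<in> \<Delta>"
  shows "provable \<Gamma> T \<Delta>"
  unfolding provable_iff_eventually_derivable
  using eventually_member_left[OF assms(1)] eventually_member_right[OF assms(2)]
  by eventually_elim (auto, metis derivable.init_id)

lemma provable_rep2:
  assumes "(\<alpha>, At n (Nom m)) \<in> \<Gamma>"
    and "(\<alpha>, subst \<phi> n k) \<in> \<Gamma>"
    and "provable (insert (\<alpha>, subst \<phi> m k) \<Gamma>) T \<Delta>"
  shows "provable \<Gamma> T \<Delta>"
  unfolding provable_iff_eventually_derivable
  using eventually_member_left[OF assms(1)] eventually_member_left[OF assms(2)]
    eventually_derivable_insert_left[OF assms(3)]
proof eventually_elim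
  case (elim S)
  obtain \<Gamma>' T' \<Delta>' where S: "S = (\<Gamma>', T', \<Delta>')"
    by (cases S)
  have "insert (\<alpha>, At n (Nom m)) \<Gamma>' = \<Gamma>'"
    using elim(1) by (simp add: S)
  then have "insert (\<alpha>, At n (Nom m)) (insert (\<alpha>, subst \<phi> m k) \<Gamma>') = insert (\<alpha>, subst \<phi> m k) \<Gamma>'"
    by (simp add: insert_commute[of "(\<alpha>, At n (Nom m))"])
  with elim have "derivable (insert (\<alpha>, At n (Nom m)) (insert (\<alpha>, subst \<phi> m k) \<Gamma>')) T' \<Delta>'"
    by (simp add: S)
  from derivable.rep2[OF this] elim show ?case
    by (simp add: S)
qed

lemma provable_ref:
  assumes "\<alpha> \<in> T"
    and "provable (insert (\<alpha>, At n (Nom n)) \<Gamma>) T \<Delta>"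
  shows "provable \<Gamma> T \<Delta>"
  unfolding provable_iff_eventually_derivable
  using eventually_member_tree[OF assms(1)] eventually_derivable_insert_left[OF assms(2)]
  by eventually_elim (auto, metis derivable.ref)

lemma provable_rigid:
  assumes "(\<alpha>, At n (Nom m)) \<in> \<Gamma>"
    and "\<beta> \<in> T"
    and "provable (insert (\<beta>, At n (Nom m)) \<Gamma>) T \<Delta>"
  shows "provable \<Gamma> T \<Delta>"
  unfolding provable_iff_eventually_derivable
  using eventually_member_left[OF assms(1)] eventually_member_tree[OF assms(2)]
    eventually_derivable_insert_left[OF assms(3)]
  by eventually_elim (auto, metis derivable.rigid)

lemma provable_ImpR:
  assumes "(\<alpha>, At n (Imp \<phi> \<psi>)) \<in> \<Delta>"
    and "provable (insert (\<alpha>, At n \<phi>) \<Gamma>) T (insert (\<alpha>, At n \<psi>) \<Delta>)"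
  shows "provable \<Gamma> T \<Delta>"
  unfolding provable_iff_eventually_derivable
  using eventually_member_right[OF assms(1)] eventually_derivable_insert_both[OF assms(2)]
  by eventually_elim (auto, metis derivable.ImpR)

lemma provable_ImpL:
  assumes "(\<alpha>, At n (Imp \<phi> \<psi>)) \<in> \<Gamma>"
    and "provable \<Gamma> T (insert (\<alpha>, At n \<phi>) \<Delta>)"
    and "provable (insert (\<alpha>, At n \<psi>) \<Gamma>) T \<Delta>"
  shows "provable \<Gamma> T \<Delta>"
  unfolding provable_iff_eventually_derivable
  using eventually_member_left[OF assms(1)] eventually_derivable_insert_right[OF assms(2)]
    eventually_derivable_insert_left[OF assms(3)]
  by eventually_elim (auto, metis derivable.ImpL)

lemma provable_AtR:
  assumes "(\<alpha>, At n (At m \<phi>)) \<in> \<Delta>"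
    and "provable \<Gamma> T (insert (\<alpha>, At m \<phi>) \<Delta>)"
  shows "provable \<Gamma> T \<Delta>"
  unfolding provable_iff_eventually_derivable
  using eventually_member_right[OF assms(1)] eventually_derivable_insert_right[OF assms(2)]
  by eventually_elim (auto, metis derivable.AtR)

lemma provable_AtL:
  assumes "(\<alpha>, At n (At m \<phi>)) \<in> \<Gamma>"
    and "provable (insert (\<alpha>, At m \<phi>) \<Gamma>) T \<Delta>"
  shows "provable \<Gamma> T \<Delta>"
  unfolding provable_iff_eventually_derivable
  using eventually_member_left[OF assms(1)] eventually_derivable_insert_left[OF assms(2)]
  by eventually_elim (auto, metis derivable.AtL)

lemma provable_FR:
  assumes "(\<alpha>, At n (Fr \<phi>)) \<in> \<Delta>"
    and "m \<notin> seq_noms \<Gamma> T \<Delta>"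
    and "provable (insert (\<alpha>, At n (DiaF (Nom m))) \<Gamma>) T (insert (\<alpha>, At m \<phi>) \<Delta>)"
  shows "provable \<Gamma> T \<Delta>"
  unfolding provable_iff_eventually_derivable
  using eventually_member_right[OF assms(1)] eventually_fresh_nom[OF assms(2)]
    eventually_derivable_insert_both[OF assms(3)]
  by eventually_elim (auto, metis derivable.FR)

lemma provable_FL:
  assumes "(\<alpha>, At n (Fr \<phi>)) \<in> \<Gamma>"
    and "provable \<Gamma> T (insert (\<alpha>, At n (DiaF (Nom m))) \<Delta>)"
    and "provable (insert (\<alpha>, At m \<phi>) \<Gamma>) T \<Delta>"
  shows "provable \<Gamma> T \<Delta>"
  unfolding provable_iff_eventually_derivable
  using eventually_member_left[OF assms(1)] eventually_derivable_insert_right[OF assms(2)]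
    eventually_derivable_insert_left[OF assms(3)]
  by eventually_elim (auto, metis derivable.FL)

lemma provable_BoxR:
  assumes "(\<alpha>, At n (Box \<phi>)) \<in> \<Delta>"
    and "i \<notin> seq_nats \<Gamma> T \<Delta>"
    and "provable \<Gamma> (insert (Child \<alpha> n i) T) (insert (Child \<alpha> n i, At n \<phi>) \<Delta>)"
  shows "provable \<Gamma> T \<Delta>"
  unfolding provable_iff_eventually_derivable
  using eventually_member_right[OF assms(1)] eventually_fresh_nat[OF assms(2)]
    eventually_derivable_insert_label[OF assms(3)]
  by eventually_elim (auto simp: fin_tree_sequent_insert_Child, metis derivable.BoxR)

lemma provable_BoxL:
  assumes "(\<alpha>, At n (Box \<phi>)) \<in> \<Gamma>"
    and "Child \<alpha> n i \<in> T"
    and "provable (insert (Child \<alpha> n i, At n \<phi>) \<Gamma>) T \<Delta>"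
  shows "provable \<Gamma> T \<Delta>"
  unfolding provable_iff_eventually_derivable
  using eventually_member_left[OF assms(1)] eventually_member_tree[OF assms(2)]
    eventually_derivable_insert_left[OF assms(3)]
  by eventually_elim (auto, metis derivable.BoxL)

end


subsection \<open>Saturated sequents\<close>

definition witnessed ::
    "('p, 'n) lfm set \<Rightarrow> 'n label set \<Rightarrow> ('p, 'n) lfm set \<Rightarrow> ('p, 'n) lfm \<Rightarrow> bool" where
  "witnessed \<Gamma> T \<Delta> x \<longleftrightarrow>
     (\<forall>\<alpha> n \<phi>. x = (\<alpha>, At n (Fr \<phi>)) \<longrightarrow> (\<exists>m. (\<alpha>, At n (DiaF (Nom m))) \<in> \<Gamma> \<and> (\<alpha>, At m \<phi>) \<in> \<Delta>)) \<and>
     (\<forall>\<alpha> n \<phi>. x = (\<alpha>, At n (Box \<phi>)) \<longrightarrow> (\<exists>i. Child \<alpha> n i \<in> T \<and> (Child \<alpha> n i, At n \<phi>) \<in> \<Delta>))"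

definition decided ::
    "('p, 'n) lfm set \<Rightarrow> 'n label set \<Rightarrow> ('p, 'n) lfm set \<Rightarrow> ('p, 'n) lfm \<Rightarrow> bool" where
  "decided \<Gamma> T \<Delta> x \<longleftrightarrow>
     (x \<in> \<Gamma> \<or> provable (insert x \<Gamma>) T \<Delta>) \<and>
     (x \<in> \<Delta> \<and> witnessed \<Gamma> T \<Delta> x \<or> provable \<Gamma> T (insert x \<Delta>))"

locale saturated =
  fixes \<Gamma> :: "('p, 'n::infinite) lfm set" and T :: "'n label set" and \<Delta> :: "('p, 'n) lfm set"
  assumes is_sequent: "tree_sequent \<Gamma> T \<Delta>"
    and unprovable: "\<not> provable \<Gamma> T \<Delta>"
    and all_decided: "fst x \<in> T \<Longrightarrow> at_prefixed (snd x) \<Longrightarrow> decided \<Gamma> T \<Delta> x"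
begin

lemma label_in_T: "(\<alpha>, \<psi>) \<in> \<Gamma> \<Longrightarrow> \<alpha> \<in> T" "(\<alpha>, \<psi>) \<in> \<Delta> \<Longrightarrow> \<alpha> \<in> T"
  using tree_sequentD[OF is_sequent] by auto

lemma maximal_left: "\<alpha> \<in> T \<Longrightarrow> at_prefixed \<psi> \<Longrightarrow> (\<alpha>, \<psi>) \<notin> \<Gamma> \<Longrightarrow> provable (insert (\<alpha>, \<psi>) \<Gamma>) T \<Delta>"
  using all_decided[of "(\<alpha>, \<psi>)"] by (simp add: decided_def)

lemma maximal_right: "\<alpha> \<in> T \<Longrightarrow> at_prefixed \<psi> \<Longrightarrow> (\<alpha>, \<psi>) \<notin> \<Delta> \<Longrightarrow> provable \<Gamma> T (insert (\<alpha>, \<psi>) \<Delta>)"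
  using all_decided[of "(\<alpha>, \<psi>)"] by (auto simp: decided_def)

lemma right_witnessed: "x \<in> \<Delta> \<Longrightarrow> witnessed \<Gamma> T \<Delta> x"
  using all_decided[of x] unprovable is_sequent
  by (auto simp: decided_def tree_sequent_iff insert_absorb)

lemma F_witness:
  assumes "(\<alpha>, At n (Fr \<phi>)) \<in> \<Delta>"
  obtains m where "(\<alpha>, At n (DiaF (Nom m))) \<in> \<Gamma>" "(\<alpha>, At m \<phi>) \<in> \<Delta>"
  using right_witnessed[OF assms] by (auto simp: witnessed_def)

lemma Box_witness:
  assumes "(\<alpha>, At n (Box \<phi>)) \<in> \<Delta>"
  obtains i where "Child \<alpha> n i \<in> T" "(Child \<alpha> n i, At n \<phi>) \<in> \<Delta>"
  using right_witnessed[OF assms] by (auto simp: witnessed_def)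

lemma disjoint: "(\<alpha>, At n \<phi>) \<in> \<Gamma> \<Longrightarrow> (\<alpha>, At n \<phi>) \<notin> \<Delta>"
  using provable_init_id[OF is_sequent] unprovable by blast

lemma Bot_notin_left: "(\<alpha>, At n Bot) \<notin> \<Gamma>"
  using provable_init_bot[OF is_sequent] unprovable by blast

lemma left_subst:
  assumes "(\<alpha>, At n (Nom m)) \<in> \<Gamma>" "(\<alpha>, subst \<phi> n k) \<in> \<Gamma>"
  shows "(\<alpha>, subst \<phi> m k) \<in> \<Gamma>"
proof (rule ccontr)
  assume "(\<alpha>, subst \<phi> m k) \<notin> \<Gamma>"
  then have "provable (insert (\<alpha>, subst \<phi> m k) \<Gamma>) T \<Delta>"
    using tree_sequentD[OF is_sequent, of \<alpha> "subst \<phi> n k"] assms(2) by (intro maximal_left) auto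
  with unprovable provable_rep2[OF is_sequent assms] show False
    by blast
qed

lemma left_Nom_refl: "\<alpha> \<in> T \<Longrightarrow> (\<alpha>, At n (Nom n)) \<in> \<Gamma>"
  using provable_ref[OF is_sequent] maximal_left unprovable at_prefixed_At by metis

lemma left_Nom_rigid: "(\<alpha>, At n (Nom m)) \<in> \<Gamma> \<Longrightarrow> \<beta> \<in> T \<Longrightarrow> (\<beta>, At n (Nom m)) \<in> \<Gamma>"
  using provable_rigid[OF is_sequent] maximal_left unprovable at_prefixed_At by metis

lemma left_Imp: "(\<alpha>, At n (Imp \<phi> \<psi>)) \<in> \<Gamma> \<Longrightarrow> (\<alpha>, At n \<phi>) \<in> \<Delta> \<or> (\<alpha>, At n \<psi>) \<in> \<Gamma>"
  using provable_ImpL[OF is_sequent] maximal_left maximal_right label_in_T unprovable at_prefixed_At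
  by metis

lemma right_Imp:
  assumes "(\<alpha>, At n (Imp \<phi> \<psi>)) \<in> \<Delta>"
  shows "(\<alpha>, At n \<phi>) \<in> \<Gamma>" "(\<alpha>, At n \<psi>) \<in> \<Delta>"
proof -
  have premise: "\<not> provable (insert (\<alpha>, At n \<phi>) \<Gamma>) T (insert (\<alpha>, At n \<psi>) \<Delta>)"
    using provable_ImpR[OF is_sequent assms] unprovable by blast
  have "\<not> provable (insert (\<alpha>, At n \<phi>) \<Gamma>) T \<Delta>" "\<not> provable \<Gamma> T (insert (\<alpha>, At n \<psi>) \<Delta>)"
    using premise provable_mono[OF _ order_refl order_refl subset_insertI]
      provable_mono[OF _ subset_insertI order_refl order_refl] by blast+
  then show "(\<alpha>, At n \<phi>) \<in> \<Gamma>" "(\<alpha>, At n \<psi>) \<in> \<Delta>"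
    using maximal_left maximal_right label_in_T(2)[OF assms] at_prefixed_At by metis+
qed

lemma left_At: "(\<alpha>, At n (At m \<phi>)) \<in> \<Gamma> \<Longrightarrow> (\<alpha>, At m \<phi>) \<in> \<Gamma>"
  using provable_AtL[OF is_sequent] maximal_left label_in_T unprovable at_prefixed_At
  by metis

lemma right_At: "(\<alpha>, At n (At m \<phi>)) \<in> \<Delta> \<Longrightarrow> (\<alpha>, At m \<phi>) \<in> \<Delta>"
  using provable_AtR[OF is_sequent] maximal_right label_in_T unprovable at_prefixed_At
  by metis

lemma left_Fr: "(\<alpha>, At n (Fr \<phi>)) \<in> \<Gamma> \<Longrightarrow> (\<alpha>, At n (DiaF (Nom m))) \<in> \<Delta> \<or> (\<alpha>, At m \<phi>) \<in> \<Gamma>"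
  using provable_FL[OF is_sequent] maximal_left maximal_right label_in_T unprovable at_prefixed_At
  by metis

lemma left_Box: "(\<alpha>, At n (Box \<phi>)) \<in> \<Gamma> \<Longrightarrow> Child \<alpha> n i \<in> T \<Longrightarrow> (Child \<alpha> n i, At n \<phi>) \<in> \<Gamma>"
  using provable_BoxL[OF is_sequent] maximal_left unprovable at_prefixed_At by metis

definition equated :: "'n \<Rightarrow> 'n \<Rightarrow> bool" where
  "equated n m \<longleftrightarrow> (\<exists>\<alpha>. (\<alpha>, At n (Nom m)) \<in> \<Gamma>)"

lemma equated_iff: "\<alpha> \<in> T \<Longrightarrow> equated n m \<longleftrightarrow> (\<alpha>, At n (Nom m)) \<in> \<Gamma>"
  unfolding equated_def using left_Nom_rigid by blast

lemma left_At_cong: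
  assumes "equated n m" "(\<alpha>, At n \<phi>) \<in> \<Gamma>"
  shows "(\<alpha>, At m \<phi>) \<in> \<Gamma>"
proof -
  obtain k where k: "k \<notin> noms \<phi>"
    using arb_element[OF finite_noms] by blast
  have subst_k: "subst (At k \<phi>) l k = At l \<phi>" for l
    using k by (auto simp: subst_def intro!: fm.map_ident_strong)
  have "(\<alpha>, At n (Nom m)) \<in> \<Gamma>"
    using assms equated_iff label_in_T(1) by blast
  from left_subst[OF this, of "At k \<phi>" k] show ?thesis
    using assms(2) by (simp add: subst_k)
qed

lemma T_nonempty: "T \<noteq> {}"
  using is_sequent by (auto simp: tree_sequent_def tree_def)

lemma equated_refl: "equated n n"
  using T_nonempty left_Nom_refl equated_iff by blast

lemma equated_sym: "equated n m \<Longrightarrow> equated m n"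
  using left_At_cong equated_refl unfolding equated_def by blast

lemma equated_trans: "equated n m \<Longrightarrow> equated m l \<Longrightarrow> equated n l"
  using left_At_cong equated_sym unfolding equated_def by blast

lemma equivp_equated: "equivp equated"
  using equated_refl equated_sym equated_trans by (intro equivpI reflpI sympI transpI)

end


subsection \<open>The canonical model\<close>

definition canonical ::
    "('p, 'n) lfm set \<Rightarrow> 'n label set \<Rightarrow> ('n label \<Rightarrow> 'w) \<Rightarrow> ('n \<Rightarrow> 'a) \<Rightarrow> ('w, 'a, 'p, 'n) model" where
  "canonical \<Gamma> T g h = \<lparr>
     worlds = g ` T,
     agents = range h,
     know = \<lambda>a. {(g \<alpha>, g (Child \<alpha> n i)) | \<alpha> n i. Child \<alpha> n i \<in> T \<and> h n = a},
     friend = \<lambda>w. {(h n, h m) | n m. \<exists>\<alpha>. w = g \<alpha> \<and> (\<alpha>, At n (DiaF (Nom m))) \<in> \<Gamma>},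
     val = case_sum (\<lambda>p. {(g \<alpha>, h n) | \<alpha> n. (\<alpha>, At n (Pro p)) \<in> \<Gamma>}) (\<lambda>n. g ` T \<times> {h n})\<rparr>"

locale canonical_model = saturated \<Gamma> T \<Delta>
  for \<Gamma> :: "('p, 'n::infinite) lfm set" and T \<Delta> +
  fixes g :: "'n label \<Rightarrow> 'w" and h :: "'n \<Rightarrow> 'a"
  assumes g_eq_iff [simp]: "g \<alpha> = g \<beta> \<longleftrightarrow> \<alpha> = \<beta>"
    and h_eq_iff [simp]: "h n = h m \<longleftrightarrow> equated n m"
begin

abbreviation M :: "('w, 'a, 'p, 'n) model" where
  "M \<equiv> canonical \<Gamma> T g h"

lemma is_model_canonical: "is_model M"
proof -
  have "tree T"
    using is_sequent by (simp add: tree_sequent_def)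
  have "val M x \<subseteq> worlds M \<times> agents M" for x
    using label_in_T by (cases x) (auto simp: canonical_def)
  then show ?thesis
    unfolding is_model_def using T_nonempty tree_parent[OF \<open>tree T\<close>]
    by (auto simp: canonical_def times_eq_iff)
qed

lemma denot_canonical: "denot M n = h n"
  unfolding denot_def using T_nonempty
  by (intro the_equality) (auto simp: canonical_def times_eq_iff)

lemma assignment_canonical: "assignment M T g"
  unfolding assignment_def denot_canonical using equated_refl by (auto simp: canonical_def)

lemma sat_Nom_canonical: "\<alpha> \<in> T \<Longrightarrow> sat M (g \<alpha>) (h n) (Nom m) \<longleftrightarrow> (\<alpha>, At n (Nom m)) \<in> \<Gamma>"
  using equated_iff equated_sym by (auto simp: denot_canonical)

lemma sat_Pro_canonical: "sat M (g \<alpha>) (h n) (Pro p) \<longleftrightarrow> (\<alpha>, At n (Pro p)) \<in> \<Gamma>"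
  by (auto simp: canonical_def) (blast intro: left_At_cong equated_refl equated_sym)+

lemma sat_Fr_canonical:
  "sat M (g \<alpha>) (h n) (Fr \<phi>) \<longleftrightarrow> (\<forall>m. (\<alpha>, At n (DiaF (Nom m))) \<in> \<Gamma> \<longrightarrow> sat M (g \<alpha>) (h m) \<phi>)"
proof -
  have "(h n, b) \<in> friend M (g \<alpha>) \<longleftrightarrow> (\<exists>m. b = h m \<and> (\<alpha>, At n (DiaF (Nom m))) \<in> \<Gamma>)" for b
    by (auto simp: canonical_def) (blast intro: left_At_cong equated_refl equated_sym)+
  then show ?thesis
    by auto
qed

lemma sat_Box_canonical:
  "sat M (g \<alpha>) (h n) (Box \<phi>) \<longleftrightarrow>
   (\<forall>m i. equated n m \<longrightarrow> Child \<alpha> m i \<in> T \<longrightarrow> sat M (g (Child \<alpha> m i)) (h n) \<phi>)"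
proof -
  have "(g \<alpha>, v) \<in> know M (h n) \<longleftrightarrow> (\<exists>m i. v = g (Child \<alpha> m i) \<and> Child \<alpha> m i \<in> T \<and> equated n m)" for v
    using equated_sym by (auto simp: canonical_def)
  then show ?thesis
    by auto
qed

lemma truth_lemma:
  "((\<alpha>, At n \<phi>) \<in> \<Gamma> \<longrightarrow> sat M (g \<alpha>) (h n) \<phi>) \<and> ((\<alpha>, At n \<phi>) \<in> \<Delta> \<longrightarrow> \<not> sat M (g \<alpha>) (h n) \<phi>)"
proof (induction \<phi> arbitrary: \<alpha> n)
  case (Nom m)
  then show ?case
    using sat_Nom_canonical label_in_T disjoint by blast
next
  case (Pro p)
  then show ?case
    using sat_Pro_canonical disjoint by blast
next
  case Bot
  then show ?case
    using Bot_notin_left by simp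
next
  case (Imp \<phi> \<psi>)
  then show ?case
    using left_Imp right_Imp by (metis sat.simps(4))
next
  case (At m \<phi>)
  then show ?case
    using left_At right_At by (auto simp: denot_canonical)
next
  case (Fr \<phi>)
  have "(\<alpha>, At m \<phi>) \<in> \<Gamma>"
    if "(\<alpha>, At n (Fr \<phi>)) \<in> \<Gamma>" "(\<alpha>, At n (DiaF (Nom m))) \<in> \<Gamma>" for m
    using left_Fr[OF that(1)] disjoint[OF that(2)] by blast
  then show ?case
    unfolding sat_Fr_canonical using F_witness Fr.IH by metis
next
  case (Box \<phi>)
  have "(Child \<alpha> m i, At n \<phi>) \<in> \<Gamma>"
    if "(\<alpha>, At n (Box \<phi>)) \<in> \<Gamma>" "equated n m" "Child \<alpha> m i \<in> T" for m i
    using left_Box left_At_cong equated_sym that by blast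
  then show ?case
    unfolding sat_Box_canonical using Box_witness equated_refl Box.IH by metis
qed

lemma not_sat_sequent_canonical: "\<not> sat_sequent M g \<Gamma> \<Delta>"
proof -
  have "sat_lfm M g x" if "x \<in> \<Gamma>" for x
  proof -
    obtain \<alpha> \<psi> where "x = (\<alpha>, \<psi>)"
      by (cases x)
    moreover from this that obtain n \<phi> where "\<psi> = At n \<phi>"
      using tree_sequentD(2)[OF is_sequent, of \<alpha> \<psi>] by (auto simp: at_prefixed_def)
    ultimately show ?thesis
      using that truth_lemma by (auto simp: sat_lfm_def denot_canonical)
  qed
  moreover have "\<not> sat_lfm M g x" if "x \<in> \<Delta>" for x
    using truth_lemma that by (auto simp: sat_lfm_def denot_canonical)
  ultimately show ?thesis
    unfolding sat_sequent_def by blast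
qed

end

instance fm :: (countable, countable) countable
  by countable_datatype

instance label :: (countable) countable
  by countable_datatype

lemma ex_inj_infinite_Compl_range:
  "\<exists>f :: 'b::countable \<Rightarrow> 'c::infinite. inj f \<and> infinite (- range f)"
proof -
  obtain e :: "nat \<Rightarrow> 'c" where e: "inj e"
    using arb_countable_map[of "{}"] by blast
  let ?f = "\<lambda>x :: 'b. e (2 * to_nat x)" and ?g = "\<lambda>i. e (Suc (2 * i))"
  have "inj ?f" "inj ?g"
    by (auto simp: inj_def dest!: injD[OF e])
  have "range ?g \<subseteq> - range ?f"
    by (auto dest!: injD[OF e]) presburger
  then have "infinite (- range ?f)"
    using finite_imageD[OF _ \<open>inj ?g\<close>] infinite_UNIV_nat finite_subset by blast
  with \<open>inj ?f\<close> show ?thesis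
    by blast
qed

lemma ex_map_eq_iff_equivp:
  assumes "equivp R"
  shows "\<exists>f :: 'b::countable \<Rightarrow> 'c::infinite. \<forall>x y. f x = f y \<longleftrightarrow> R x y"
proof -
  obtain e :: "'b \<Rightarrow> 'c" where e: "inj e"
    using ex_inj_infinite_Compl_range by blast
  let ?f = "\<lambda>x. e (SOME y. R x y)"
  have "?f x = ?f y \<longleftrightarrow> R x y" for x y
  proof
    have related_choice: "R x (SOME y. R x y)" for x
      using equivp_reflp[OF assms] by (rule someI)
    show "R x y" if "?f x = ?f y"
      using injD[OF e that] related_choice[of x] related_choice[of y] assms by (metis equivp_def)
    show "?f x = ?f y" if "R x y"
      using that assms by (simp add: equivp_def)
  qed
  then show ?thesis
    by (intro exI[of _ ?f]) blast
qed

lemma saturated_countermodel: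
  fixes \<Gamma> :: "('p, 'n::{countable,infinite}) lfm set"
  assumes "saturated \<Gamma> T \<Delta>"
  obtains M :: "('w::infinite, 'a::infinite, 'p, 'n) model" and f
  where "is_model M" "assignment M T f" "\<not> sat_sequent M f \<Gamma> \<Delta>"
proof -
  interpret saturated \<Gamma> T \<Delta>
    by fact
  obtain g :: "'n label \<Rightarrow> 'w" where "\<forall>\<alpha> \<beta>. g \<alpha> = g \<beta> \<longleftrightarrow> \<alpha> = \<beta>"
    using ex_map_eq_iff_equivp[OF identity_equivp] by blast
  moreover obtain h :: "'n \<Rightarrow> 'a" where "\<forall>n m. h n = h m \<longleftrightarrow> equated n m"
    using ex_map_eq_iff_equivp[OF equivp_equated] by blast
  ultimately interpret canonical_model \<Gamma> T \<Delta> g h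
    by unfold_locales auto
  show thesis
    using is_model_canonical assignment_canonical not_sat_sequent_canonical by (rule that)
qed


subsection \<open>Extending unprovable sequents\<close>

definition extendable ::
    "('p, 'n) lfm set \<Rightarrow> 'n label set \<Rightarrow> ('p, 'n) lfm set \<Rightarrow> bool" where
  "extendable \<Gamma> T \<Delta> \<longleftrightarrow> tree_sequent \<Gamma> T \<Delta> \<and> \<not> provable \<Gamma> T \<Delta> \<and>
     infinite (- seq_noms \<Gamma> T \<Delta>) \<and> infinite (- seq_nats \<Gamma> T \<Delta>)"

lemma finite_Compl_Int_iff: "finite F \<Longrightarrow> finite (- F \<inter> A) \<longleftrightarrow> finite A"
  by (simp add: Int_commute[of "- F"] flip: Diff_eq)

lemma finite_Compl_insert_iff: "finite (- insert x A) \<longleftrightarrow> finite (- A)"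
  by (simp add: Compl_insert)

lemmas extendable_insert_simps =
  extendable_def seq_noms_insert seq_nats_insert
  finite_Compl_insert_iff finite_Compl_Int_iff Int_assoc

lemma extendable_insert_left:
  assumes "extendable \<Gamma> T \<Delta>" "fst x \<in> T" "at_prefixed (snd x)" "\<not> provable (insert x \<Gamma>) T \<Delta>"
  shows "extendable (insert x \<Gamma>) T \<Delta>"
  using assms by (simp add: extendable_insert_simps)

lemma extendable_insert_right:
  assumes "extendable \<Gamma> T \<Delta>" "fst x \<in> T" "at_prefixed (snd x)" "\<not> provable \<Gamma> T (insert x \<Delta>)"
  shows "extendable \<Gamma> T (insert x \<Delta>)"
  using assms by (simp add: extendable_insert_simps)

lemma extendable_F_witness:
  fixes \<Gamma> \<Delta> :: "('p, 'n::infinite) lfm set"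
  assumes "extendable \<Gamma> T \<Delta>" "(\<alpha>, At n (Fr \<phi>)) \<in> \<Delta>"
  obtains m where "extendable (insert (\<alpha>, At n (DiaF (Nom m))) \<Gamma>) T (insert (\<alpha>, At m \<phi>) \<Delta>)"
proof -
  have is_sequent: "tree_sequent \<Gamma> T \<Delta>" and "infinite (- seq_noms \<Gamma> T \<Delta>)"
    using assms(1) by (simp_all add: extendable_def)
  then obtain m where "m \<notin> seq_noms \<Gamma> T \<Delta>"
    using infinite_imp_nonempty by blast
  then have "\<not> provable (insert (\<alpha>, At n (DiaF (Nom m))) \<Gamma>) T (insert (\<alpha>, At m \<phi>) \<Delta>)"
    using provable_FR[OF is_sequent assms(2)] assms(1) by (auto simp: extendable_def)
  moreover have "\<alpha> \<in> T"
    using tree_sequentD(1)[OF is_sequent] assms(2) by blast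
  ultimately have "extendable (insert (\<alpha>, At n (DiaF (Nom m))) \<Gamma>) T (insert (\<alpha>, At m \<phi>) \<Delta>)"
    using assms(1) by (simp add: extendable_insert_simps)
  then show thesis
    by (rule that)
qed

lemma extendable_Box_witness:
  fixes \<Gamma> \<Delta> :: "('p, 'n::infinite) lfm set"
  assumes "extendable \<Gamma> T \<Delta>" "(\<alpha>, At n (Box \<phi>)) \<in> \<Delta>"
  obtains i where "extendable \<Gamma> (insert (Child \<alpha> n i) T) (insert (Child \<alpha> n i, At n \<phi>) \<Delta>)"
proof -
  have is_sequent: "tree_sequent \<Gamma> T \<Delta>" and "infinite (- seq_nats \<Gamma> T \<Delta>)"
    using assms(1) by (simp_all add: extendable_def)
  then obtain i where "i \<notin> seq_nats \<Gamma> T \<Delta>"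
    using infinite_imp_nonempty by blast
  then have "\<not> provable \<Gamma> (insert (Child \<alpha> n i) T) (insert (Child \<alpha> n i, At n \<phi>) \<Delta>)"
    using provable_BoxR[OF is_sequent assms(2)] assms(1) by (auto simp: extendable_def)
  moreover have "\<alpha> \<in> T"
    using tree_sequentD(1)[OF is_sequent] assms(2) by blast
  ultimately have "extendable \<Gamma> (insert (Child \<alpha> n i) T) (insert (Child \<alpha> n i, At n \<phi>) \<Delta>)"
    using assms(1) tree_sequent_insert_Child[OF is_sequent] by (simp add: extendable_insert_simps)
  then show thesis
    by (rule that)
qed

lemma extendable_insert_witnessed:
  fixes \<Gamma> \<Delta> :: "('p, 'n::infinite) lfm set"
  assumes "extendable \<Gamma> T \<Delta>" "fst x \<in> T" "at_prefixed (snd x)" "\<not> provable \<Gamma> T (insert x \<Delta>)"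
  obtains \<Gamma>' T' \<Delta>' where "(\<Gamma>, T, \<Delta>) \<le> (\<Gamma>', T', \<Delta>')" "extendable \<Gamma>' T' \<Delta>'"
    and "x \<in> \<Delta>'" "witnessed \<Gamma>' T' \<Delta>' x"
proof -
  have extendable: "extendable \<Gamma> T (insert x \<Delta>)"
    using assms by (rule extendable_insert_right)
  consider (F) \<alpha> n \<phi> where "x = (\<alpha>, At n (Fr \<phi>))" | (Box) \<alpha> n \<phi> where "x = (\<alpha>, At n (Box \<phi>))"
    | (other) "\<nexists>\<alpha> n \<phi>. x = (\<alpha>, At n (Fr \<phi>)) \<or> x = (\<alpha>, At n (Box \<phi>))"
    by blast
  then show thesis
  proof cases
    case F
    then obtain m where "extendable (insert (\<alpha>, At n (DiaF (Nom m))) \<Gamma>) T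
        (insert (\<alpha>, At m \<phi>) (insert x \<Delta>))"
      using extendable_F_witness[OF extendable, of \<alpha> n \<phi>] by blast
    then show thesis
      by (rule that[rotated]) (auto simp: witnessed_def F)
  next
    case Box
    then obtain i where "extendable \<Gamma> (insert (Child \<alpha> n i) T)
        (insert (Child \<alpha> n i, At n \<phi>) (insert x \<Delta>))"
      using extendable_Box_witness[OF extendable, of \<alpha> n \<phi>] by blast
    then show thesis
      by (rule that[rotated]) (auto simp: witnessed_def Box)
  next
    case other
    with extendable show thesis
      by (intro that[of \<Gamma> T "insert x \<Delta>"]) (auto simp: witnessed_def)
  qed
qed

lemma witnessed_mono:
  "witnessed \<Gamma> T \<Delta> x \<Longrightarrow> \<Gamma> \<subseteq> \<Gamma>' \<Longrightarrow> T \<subseteq> T' \<Longrightarrow> \<Delta> \<subseteq> \<Delta>' \<Longrightarrow> witnessed \<Gamma>' T' \<Delta>' x"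
  unfolding witnessed_def by blast

lemma decided_mono:
  assumes "decided \<Gamma> T \<Delta> x" "\<Gamma> \<subseteq> \<Gamma>'" "T \<subseteq> T'" "\<Delta> \<subseteq> \<Delta>'"
  shows "decided \<Gamma>' T' \<Delta>' x"
  using assms witnessed_mono[OF _ assms(2-4)]
    provable_mono[OF _ insert_mono[OF assms(2)] assms(3,4)]
    provable_mono[OF _ assms(2,3) insert_mono[OF assms(4)]]
  unfolding decided_def by blast

lemma extendable_decide:
  fixes \<Gamma> \<Delta> :: "('p, 'n::infinite) lfm set"
  assumes "extendable \<Gamma> T \<Delta>" "fst x \<in> T" "at_prefixed (snd x)"
  obtains \<Gamma>' T' \<Delta>' where "(\<Gamma>, T, \<Delta>) \<le> (\<Gamma>', T', \<Delta>')" "extendable \<Gamma>' T' \<Delta>'" "decided \<Gamma>' T' \<Delta>' x"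
proof -
  define \<Gamma>\<^sub>1 where "\<Gamma>\<^sub>1 = (if provable (insert x \<Gamma>) T \<Delta> then \<Gamma> else insert x \<Gamma>)"
  have "\<Gamma> \<subseteq> \<Gamma>\<^sub>1" and left: "x \<in> \<Gamma>\<^sub>1 \<or> provable (insert x \<Gamma>\<^sub>1) T \<Delta>"
    and extendable: "extendable \<Gamma>\<^sub>1 T \<Delta>"
    using assms extendable_insert_left[OF assms] by (auto simp: \<Gamma>\<^sub>1_def)
  show thesis
  proof (cases "provable \<Gamma>\<^sub>1 T (insert x \<Delta>)")
    case True
    with left have "decided \<Gamma>\<^sub>1 T \<Delta> x"
      by (simp add: decided_def)
    with \<open>\<Gamma> \<subseteq> \<Gamma>\<^sub>1\<close> extendable show thesis
      by (intro that[of \<Gamma>\<^sub>1 T \<Delta>]) simp_all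
  next
    case False
    obtain \<Gamma>' T' \<Delta>' where above: "(\<Gamma>\<^sub>1, T, \<Delta>) \<le> (\<Gamma>', T', \<Delta>')"
      and "extendable \<Gamma>' T' \<Delta>'" "x \<in> \<Delta>'" "witnessed \<Gamma>' T' \<Delta>' x"
      using extendable_insert_witnessed[OF extendable assms(2,3) False] by blast
    moreover have "x \<in> \<Gamma>' \<or> provable (insert x \<Gamma>') T' \<Delta>'"
      using left above provable_mono[of "insert x \<Gamma>\<^sub>1" T \<Delta> "insert x \<Gamma>'" T' \<Delta>'] by auto
    ultimately show thesis
      using \<open>\<Gamma> \<subseteq> \<Gamma>\<^sub>1\<close> by (intro that[of \<Gamma>' T' \<Delta>']) (auto simp: decided_def)
  qed
qed


subsection \<open>Limits of chains\<close>

lemma ex_recurrent_enumeration: "\<exists>e :: nat \<Rightarrow> 'a::countable. \<forall>x K. \<exists>k\<ge>K. e k = x"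
proof (intro exI[of _ "\<lambda>k. from_nat (fst (prod_decode k))"] allI)
  show "\<exists>k\<ge>K. from_nat (fst (prod_decode k)) = x" for x :: 'a and K
    by (intro exI[of _ "prod_encode (to_nat x, K)"]) (simp add: le_prod_encode_2)
qed

text \<open>Every requirement has to be met arbitrarily late in the chain, because a labelled formula can
  only be decided once its label has entered the tree.\<close>

lemma ex_generic_chain:
  fixes S\<^sub>0 :: "'s::order" and D :: "'s \<Rightarrow> 'd::countable \<Rightarrow> bool"
  assumes "P S\<^sub>0" and dense: "\<And>S d. P S \<Longrightarrow> \<exists>S'\<ge>S. P S' \<and> D S' d"
  obtains S :: "nat \<Rightarrow> 's" where "S 0 = S\<^sub>0" "mono S" "\<And>k. P (S k)" "\<And>d K. \<exists>k\<ge>K. D (S k) d"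
proof -
  obtain e :: "nat \<Rightarrow> 'd" where recurrent: "\<exists>k\<ge>K. e k = d" for K d
    using ex_recurrent_enumeration by metis
  have "\<exists>S. \<forall>k. (P (S k) \<and> (k = 0 \<longrightarrow> S k = S\<^sub>0)) \<and> (S k \<le> S (Suc k) \<and> D (S (Suc k)) (e k))"
    using assms by (intro dependent_nat_choice) blast+
  then obtain S where "S 0 = S\<^sub>0" "\<And>k. P (S k)" "\<And>k. S k \<le> S (Suc k)"
    and step: "\<And>k. D (S (Suc k)) (e k)"
    by blast
  moreover have "\<exists>k\<ge>K. D (S k) d" for d K
    using recurrent[of K d] step by (metis le_SucI)
  ultimately show thesis
    by (intro that[of S]) (simp_all add: mono_iff_le_Suc)
qed

lemma eventually_subset_chain:
  fixes A :: "nat \<Rightarrow> 'a set"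
  assumes "mono A" "finite F" "F \<subseteq> (\<Union>k. A k)"
  shows "\<forall>\<^sub>F k in sequentially. F \<subseteq> A k"
proof -
  have "\<forall>\<^sub>F k in sequentially. x \<in> A k" if "x \<in> F" for x
  proof -
    obtain K where "x \<in> A K"
      using \<open>x \<in> F\<close> assms(3) by blast
    then show ?thesis
      using monoD[OF assms(1)] unfolding eventually_sequentially by blast
  qed
  then have "\<forall>\<^sub>F k in sequentially. \<forall>x\<in>F. x \<in> A k"
    using assms(2) by (simp add: eventually_ball_finite)
  then show ?thesis
    unfolding subset_eq .
qed

lemma tree_sequent_UN_chain:
  fixes T :: "nat \<Rightarrow> 'n label set"
  assumes "mono T" "\<And>k. tree_sequent (\<Gamma> k) (T k) (\<Delta> k)"
  shows "tree_sequent (\<Union>k. \<Gamma> k) (\<Union>k. T k) (\<Union>k. \<Delta> k)"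
proof -
  have tree: "tree (T k)" for k
    using assms(2) by (simp add: tree_sequent_def)
  obtain r where "Root r \<in> T 0"
    using tree by (rule tree_obtain_Root)
  then have "Root r \<in> T k" for k
    using monoD[OF assms(1), of 0 k] by blast
  with tree have "tree (\<Union>k. T k)"
    by (intro tree_UN) auto
  then show ?thesis
    using assms(2) unfolding tree_sequent_iff by blast
qed

lemma provable_UN_chain:
  fixes \<Gamma> \<Delta> :: "nat \<Rightarrow> ('p, 'n) lfm set"
  assumes mono: "mono \<Gamma>" "mono T" "mono \<Delta>"
    and "provable (\<Union>k. \<Gamma> k) (\<Union>k. T k) (\<Union>k. \<Delta> k)"
  shows "\<exists>k. provable (\<Gamma> k) (T k) (\<Delta> k)"
proof -
  obtain \<Gamma>' T' \<Delta>' where subset: "\<Gamma>' \<subseteq> (\<Union>k. \<Gamma> k)" "T' \<subseteq> (\<Union>k. T k)" "\<Delta>' \<subseteq> (\<Union>k. \<Delta> k)"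
    and finite: "finite \<Gamma>'" "finite T'" "finite \<Delta>'" and "derivable \<Gamma>' T' \<Delta>'"
    using assms(4) unfolding provable_def by blast
  have "\<forall>\<^sub>F k in sequentially. \<Gamma>' \<subseteq> \<Gamma> k \<and> T' \<subseteq> T k \<and> \<Delta>' \<subseteq> \<Delta> k"
    by (intro eventually_conj eventually_subset_chain mono subset finite)
  then obtain k where "\<Gamma>' \<subseteq> \<Gamma> k" "T' \<subseteq> T k" "\<Delta>' \<subseteq> \<Delta> k"
    using eventually_happens by force
  with \<open>derivable \<Gamma>' T' \<Delta>'\<close> show ?thesis
    unfolding provable_iff_derivable_subset by blast
qed

lemma saturated_UN_chain:
  fixes \<Gamma> \<Delta> :: "nat \<Rightarrow> ('p, 'n::infinite) lfm set"
  assumes mono: "mono \<Gamma>" "mono T" "mono \<Delta>"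
    and extendable: "\<And>k. extendable (\<Gamma> k) (T k) (\<Delta> k)"
    and decided_late: "\<And>x K. \<exists>k\<ge>K. fst x \<in> T k \<and> at_prefixed (snd x) \<longrightarrow> decided (\<Gamma> k) (T k) (\<Delta> k) x"
  shows "saturated (\<Union>k. \<Gamma> k) (\<Union>k. T k) (\<Union>k. \<Delta> k)"
proof
  show "tree_sequent (\<Union>k. \<Gamma> k) (\<Union>k. T k) (\<Union>k. \<Delta> k)"
    using extendable by (intro tree_sequent_UN_chain mono(2)) (simp add: extendable_def)
  show "\<not> provable (\<Union>k. \<Gamma> k) (\<Union>k. T k) (\<Union>k. \<Delta> k)"
    using extendable provable_UN_chain[OF mono] by (auto simp: extendable_def)
  fix x :: "('p, 'n) lfm"
  assume "fst x \<in> (\<Union>k. T k)" "at_prefixed (snd x)"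
  then obtain K where "fst x \<in> T K"
    by blast
  obtain k where "k \<ge> K"
    and decided_at_k: "fst x \<in> T k \<and> at_prefixed (snd x) \<longrightarrow> decided (\<Gamma> k) (T k) (\<Delta> k) x"
    using decided_late[of K x] by blast
  have "fst x \<in> T k"
    using monoD[OF mono(2) \<open>k \<ge> K\<close>] \<open>fst x \<in> T K\<close> by blast
  with decided_at_k \<open>at_prefixed (snd x)\<close> have "decided (\<Gamma> k) (T k) (\<Delta> k) x"
    by blast
  then show "decided (\<Union>k. \<Gamma> k) (\<Union>k. T k) (\<Union>k. \<Delta> k) x"
    by (rule decided_mono) blast+
qed

lemma ex_saturated:
  fixes \<Gamma> \<Delta> :: "('p::countable, 'n::{countable,infinite}) lfm set"
  assumes "extendable \<Gamma> T \<Delta>"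
  obtains \<Gamma>' T' \<Delta>' where "\<Gamma> \<subseteq> \<Gamma>'" "T \<subseteq> T'" "\<Delta> \<subseteq> \<Delta>'" "saturated \<Gamma>' T' \<Delta>'"
proof -
  let ?P = "\<lambda>(\<Gamma>, T, \<Delta>). extendable \<Gamma> T \<Delta>"
  let ?D = "\<lambda>(\<Gamma>, T, \<Delta>) x. fst x \<in> T \<and> at_prefixed (snd x) \<longrightarrow> decided \<Gamma> T \<Delta> x"
  have dense: "\<exists>S'\<ge>S. ?P S' \<and> ?D S' x" if "?P S" for S :: "('p, 'n) sequent" and x
  proof (cases "?D S x")
    case True
    with that show ?thesis
      by blast
  next
    case False
    obtain \<Gamma>\<^sub>1 T\<^sub>1 \<Delta>\<^sub>1 where "S = (\<Gamma>\<^sub>1, T\<^sub>1, \<Delta>\<^sub>1)"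
      by (cases S)
    with that False obtain \<Gamma>' T' \<Delta>'
      where "S \<le> (\<Gamma>', T', \<Delta>')" "extendable \<Gamma>' T' \<Delta>'" "decided \<Gamma>' T' \<Delta>' x"
      using extendable_decide[of \<Gamma>\<^sub>1 T\<^sub>1 \<Delta>\<^sub>1 x] by auto
    then show ?thesis
      by (intro exI[of _ "(\<Gamma>', T', \<Delta>')"]) simp
  qed
  have "?P (\<Gamma>, T, \<Delta>)"
    using assms by simp
  then show thesis
  proof (rule ex_generic_chain[OF _ dense])
    fix S :: "nat \<Rightarrow> ('p, 'n) sequent"
    assume S: "S 0 = (\<Gamma>, T, \<Delta>)" "mono S" "\<And>k. ?P (S k)" "\<And>x K. \<exists>k\<ge>K. ?D (S k) x"
    define G U H where "G k = fst (S k)" and "U k = fst (snd (S k))" and "H k = snd (snd (S k))"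
      for k
    have "mono G" "mono U" "mono H"
      using S(2) by (auto simp: mono_def G_def U_def H_def less_eq_prod_def)
    moreover have "extendable (G k) (U k) (H k)" for k
      using S(3)[of k] by (simp add: G_def U_def H_def case_prod_beta)
    moreover have "\<exists>k\<ge>K. fst x \<in> U k \<and> at_prefixed (snd x) \<longrightarrow> decided (G k) (U k) (H k) x" for x K
      using S(4)[of K x] by (simp add: G_def U_def H_def case_prod_beta)
    ultimately have "saturated (\<Union>k. G k) (\<Union>k. U k) (\<Union>k. H k)"
      by (rule saturated_UN_chain)
    moreover have "G 0 = \<Gamma>" "U 0 = T" "H 0 = \<Delta>"
      by (simp_all add: S(1) G_def U_def H_def)
    then have "\<Gamma> \<subseteq> (\<Union>k. G k)" "T \<subseteq> (\<Union>k. U k)" "\<Delta> \<subseteq> (\<Union>k. H k)"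
      by (metis UN_upper UNIV_I)+
    ultimately show thesis
      using that by blast
  qed
qed


subsection \<open>Completeness\<close>

lemma ex_countermodel:
  fixes \<Gamma> \<Delta> :: "('p::countable, 'n::{countable,infinite}) lfm set"
  assumes "extendable \<Gamma> T \<Delta>"
  obtains M :: "('w::infinite, 'a::infinite, 'p, 'n) model" and f
  where "is_model M" "assignment M T f" "\<not> sat_sequent M f \<Gamma> \<Delta>"
proof -
  obtain \<Gamma>' T' \<Delta>' where subset: "\<Gamma> \<subseteq> \<Gamma>'" "T \<subseteq> T'" "\<Delta> \<subseteq> \<Delta>'" and "saturated \<Gamma>' T' \<Delta>'"
    using ex_saturated[OF assms] .
  then obtain M :: "('w, 'a, 'p, 'n) model" and f
    where M: "is_model M" "assignment M T' f" "\<not> sat_sequent M f \<Gamma>' \<Delta>'"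
    using saturated_countermodel by blast
  have "assignment M T f"
    using M(2) subset(2) unfolding assignment_def by blast
  moreover have "\<not> sat_sequent M f \<Gamma> \<Delta>"
    using M(3) subset(1,3) unfolding sat_sequent_def by blast
  ultimately show thesis
    using that M(1) by blast
qed

definition reduct :: "('n \<Rightarrow> 'm) \<Rightarrow> ('w, 'a, 'p, 'm) model \<Rightarrow> ('w, 'a, 'p, 'n) model" where
  "reduct \<sigma> M = \<lparr>worlds = worlds M, agents = agents M, know = know M, friend = friend M,
     val = \<lambda>x. val M (map_sum id \<sigma> x)\<rparr>"

lemma is_model_reduct: "is_model M \<Longrightarrow> is_model (reduct \<sigma> M)"
  by (simp add: is_model_def reduct_def)

lemma denot_reduct: "denot (reduct \<sigma> M) n = denot M (\<sigma> n)"
  by (simp add: denot_def reduct_def)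

lemma sat_reduct: "sat (reduct \<sigma> M) w a \<phi> \<longleftrightarrow> sat M w a (map_fm id \<sigma> \<phi>)"
  by (induction \<phi> arbitrary: w a) (simp_all add: denot_reduct, simp_all add: reduct_def)

lemma sat_lfm_reduct:
  "sat_lfm (reduct \<sigma> M) (f \<circ> rename_label \<sigma> \<tau>) x \<longleftrightarrow> sat_lfm M f (rename_lfm \<sigma> \<tau> x)"
proof (cases x)
  case (Pair \<alpha> \<psi>)
  then show ?thesis
    by (cases \<psi>) (auto simp: sat_lfm_def denot_reduct sat_reduct)
qed

lemma sat_sequent_reduct:
  "sat_sequent (reduct \<sigma> M) (f \<circ> rename_label \<sigma> \<tau>) \<Gamma> \<Delta> \<longleftrightarrow>
   sat_sequent M f (rename_lfm \<sigma> \<tau> ` \<Gamma>) (rename_lfm \<sigma> \<tau> ` \<Delta>)"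
  by (simp add: sat_sequent_def sat_lfm_reduct)

lemma assignment_reduct:
  "assignment M (rename_label \<sigma> \<tau> ` T) f \<Longrightarrow> assignment (reduct \<sigma> M) T (f \<circ> rename_label \<sigma> \<tau>)"
  unfolding assignment_def denot_reduct by (force simp: reduct_def)

lemma provable_rename:
  fixes \<sigma> :: "'n \<Rightarrow> 'm::infinite"
  assumes "provable \<Gamma> T \<Delta>"
  shows "provable (rename_lfm \<sigma> \<tau> ` \<Gamma>) (rename_label \<sigma> \<tau> ` T) (rename_lfm \<sigma> \<tau> ` \<Delta>)"
proof -
  obtain \<Gamma>' T' \<Delta>' where "\<Gamma>' \<subseteq> \<Gamma>" "T' \<subseteq> T" "\<Delta>' \<subseteq> \<Delta>" "derivable \<Gamma>' T' \<Delta>'"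
    using assms unfolding provable_iff_derivable_subset by blast
  then show ?thesis
    unfolding provable_iff_derivable_subset by (meson derivable_rename image_mono)
qed

lemma provable_rename_iff:
  fixes \<sigma> :: "'n::infinite \<Rightarrow> 'm::infinite"
  assumes "inj \<sigma>" "inj \<tau>"
  shows "provable (rename_lfm \<sigma> \<tau> ` \<Gamma>) (rename_label \<sigma> \<tau> ` T) (rename_lfm \<sigma> \<tau> ` \<Delta>) \<longleftrightarrow> provable \<Gamma> T \<Delta>"
proof
  assume "provable (rename_lfm \<sigma> \<tau> ` \<Gamma>) (rename_label \<sigma> \<tau> ` T) (rename_lfm \<sigma> \<tau> ` \<Delta>)"
  from provable_rename[OF this, of "inv \<sigma>" "inv \<tau>"] show "provable \<Gamma> T \<Delta>"
    using assms by (simp add: image_image rename_lfm_comp rename_label_comp)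
qed (rule provable_rename)

lemma extendable_rename:
  fixes \<sigma> :: "'n::infinite \<Rightarrow> 'm::infinite"
  assumes "tree_sequent \<Gamma> T \<Delta>" "\<not> provable \<Gamma> T \<Delta>"
    and "inj \<sigma>" "infinite (- range \<sigma>)" "inj \<tau>" "infinite (- range \<tau>)"
  shows "extendable (rename_lfm \<sigma> \<tau> ` \<Gamma>) (rename_label \<sigma> \<tau> ` T) (rename_lfm \<sigma> \<tau> ` \<Delta>)"
  unfolding extendable_def
proof (intro conjI)
  let ?\<Gamma> = "rename_lfm \<sigma> \<tau> ` \<Gamma>" and ?T = "rename_label \<sigma> \<tau> ` T" and ?\<Delta> = "rename_lfm \<sigma> \<tau> ` \<Delta>"
  show "tree_sequent ?\<Gamma> ?T ?\<Delta>"
    using assms(1) by (rule tree_sequent_rename)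
  show "\<not> provable ?\<Gamma> ?T ?\<Delta>"
    using assms(2) by (simp add: provable_rename_iff assms(3,5))
  show "infinite (- seq_noms ?\<Gamma> ?T ?\<Delta>)"
    using assms(4)
    by (rule contrapos_nn) (metis Compl_anti_mono finite_subset seq_noms_rename_subset)
  show "infinite (- seq_nats ?\<Gamma> ?T ?\<Delta>)"
    using assms(6)
    by (rule contrapos_nn) (metis Compl_anti_mono finite_subset seq_nats_rename_subset)
qed

theorem theorem2:
  fixes \<Gamma> \<Delta> :: "('p::{countable,infinite}, 'n::{countable,infinite}) lfm set"
    and T :: "'n label set"
  assumes "tree_sequent \<Gamma> T \<Delta>"
    and "\<And>(M :: ('w::infinite, 'a::infinite, 'p, 'n) model) f.
           is_model M \<Longrightarrow> assignment M T f \<Longrightarrow> sat_sequent M f \<Gamma> \<Delta>"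
  shows "provable \<Gamma> T \<Delta>"
proof (rule ccontr)
  assume "\<not> provable \<Gamma> T \<Delta>"
  obtain \<sigma> :: "'n \<Rightarrow> 'n" and \<tau> :: "nat \<Rightarrow> nat"
    where "inj \<sigma>" "infinite (- range \<sigma>)" "inj \<tau>" "infinite (- range \<tau>)"
    using ex_inj_infinite_Compl_range by metis
  with assms(1) \<open>\<not> provable \<Gamma> T \<Delta>\<close>
  have "extendable (rename_lfm \<sigma> \<tau> ` \<Gamma>) (rename_label \<sigma> \<tau> ` T) (rename_lfm \<sigma> \<tau> ` \<Delta>)"
    by (rule extendable_rename)
  then obtain M :: "('w, 'a, 'p, 'n) model" and f where "is_model M"
    and "assignment M (rename_label \<sigma> \<tau> ` T) f"
    and "\<not> sat_sequent M f (rename_lfm \<sigma> \<tau> ` \<Gamma>) (rename_lfm \<sigma> \<tau> ` \<Delta>)"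
    by (rule ex_countermodel)
  then have "is_model (reduct \<sigma> M)" "assignment (reduct \<sigma> M) T (f \<circ> rename_label \<sigma> \<tau>)"
    and "\<not> sat_sequent (reduct \<sigma> M) (f \<circ> rename_label \<sigma> \<tau>) \<Gamma> \<Delta>"
    by (simp_all add: is_model_reduct assignment_reduct sat_sequent_reduct)
  with assms(2) show False
    by blast
qed

end
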